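(* Assume (A) or (B), with $\alpha=a$ in case (A) and $\alpha=b$ in case (B). Let $p>p_*(\alpha):=1+\frac{2}{n+\alpha}$ and set $r_*:=\frac{n+\alpha}{2}(p-1)>1$. Then: (i) There is $\delta>0$ such that for every nonnegative $u_0\in L^\infty(\mathbb{R}^n)\cap L^{r_*,\infty}(w)$ with $\|u_0\|_{L^{r_*,\infty}(w)}<\delta$, there exists a unique global-in-time solution $u$ of problem (P), and it satisfies $$\sup_{t>0}(1+t)^{\frac{n+\alpha}{2}\left(\frac1{r_*}-\frac1q\right)}\|u(t)\|_{L^{q,\infty}(w)}<\infty\quad\text{for all } r_*\le q\le\infty.$$ (ii) Let $1\le r\le r_*$. There is $\delta>0$ such that for every nonnegative $u_0\in L^\infty(\mathbb{R}^n)\cap L^r(w)$ with $\|u_0\|_{L^r(w)}^{r/r_*}\|u_0\|_{\infty}^{1-r/r_*}<\delta$, there exists a unique global-in-time solution $u$ of (P), and it satisfies $$\sup_{t>0}(1+t)^{\frac{n+\alpha}{2}\left(\frac1{r}-\frac1q\right)}\|u(t)\|_{L^{q}(w)}<\infty\quad\text{for all } r\le q\le\infty.$$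
   Context: (A): $w(x)=|x_1|^a$ on $\mathbb{R}^n$ with $a\in[0,1)$; (B): $w(x)=|x|^b$ with $b\in[0,n)$; $n\ge1$. Problem (P): $\partial_t u-w^{-1}\operatorname{div}(w\nabla u)=u^p$ in $\mathbb{R}^n\times(0,\infty)$, $u(\cdot,0)=u_0\ge0$. $\Gamma$ is the fundamental solution of $\partial_t v-w^{-1}\operatorname{div}(w\nabla v)=0$ with pole at $(y,0)$, assumed to satisfy (K1) $\int\Gamma(x,y,t)w(x)dx=\int\Gamma(x,y,t)w(y)dy=1$; (K2) $\Gamma(x,y,t)=\int\Gamma(x,\xi,t-s)\Gamma(\xi,y,s)w(\xi)d\xi$ for $t>s>0$; (K3) two-sided Gaussian bounds $c_*e^{-|x-y|^2/(c_*t)}\le \sqrt{w(B(x,\sqrt t))w(B(y,\sqrt t))}\,\Gamma(x,y,t)\le C_*e^{-|x-y|^2/(C_*t)}$ with $c_*,C_*$ depending on $n,\alpha$. A solution in $\mathbb{R}^n\times(0,T)$ is a nonnegative measurable $u\in L^\infty(0,T;L^\infty)$ with $u(x,t)=\int\Gamma(x,y,t)u_0(y)w(y)dy+\int_0^t\int\Gamma(x,y,t-s)u(y,s)^pw(y)dyds<\infty$ for a.e. $x$ and all $t\in(0,T)$; global-in-time means $T=\infty$. Weighted spaces: $\|f\|_{L^r(w)}=(\int|f|^rw\,dx)^{1/r}$; $\mu_f(\lambda)=w(\{|f|>\lambda\})$; $f^*(s)=\inf\{\lambda>0:\mu_f(\lambda)\le s\}$; $\|f\|_{L^{r,\sigma}(w)}=(\int_0^\infty[s^{1/r}f^*(s)]^\sigma\frac{ds}{s})^{1/\sigma}$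 for $1\le\sigma<\infty$ and $\sup_{s>0}s^{1/r}f^*(s)$ for $\sigma=\infty$; $L^{\infty,\infty}(w)=L^\infty$. *)

theory Defs
  imports "HOL-Analysis.Analysis"
begin

definition wmeas :: "('a::euclidean_space \<Rightarrow> real) \<Rightarrow> 'a measure" where
  "wmeas w = density lebesgue (\<lambda>x. ennreal (w x))"

text \<open>Weights of cases (A) and (B); real powers with the convention t^0 = 1.\<close>
definition weightA :: "'n::finite \<Rightarrow> real \<Rightarrow> real^'n \<Rightarrow> real" where
  "weightA i a x = (if a = 0 then 1 else \<bar>x $ i\<bar> powr a)"

definition weightB :: "real \<Rightarrow> 'a::euclidean_space \<Rightarrow> real" where
  "weightB b x = (if b = 0 then 1 else norm x powr b)"

definition wdistr :: "('a::euclidean_space \<Rightarrow> real) \<Rightarrow> ('a \<Rightarrow> real) \<Rightarrow> real \<Rightarrow> ennreal" where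
  "wdistr w f lam = emeasure (wmeas w) {x. lam < \<bar>f x\<bar>}"

definition wrearr :: "('a::euclidean_space \<Rightarrow> real) \<Rightarrow> ('a \<Rightarrow> real) \<Rightarrow> real \<Rightarrow> ennreal" where
  "wrearr w f s = (INF lam\<in>{lam. 0 < lam \<and> wdistr w f lam \<le> ennreal s}. ennreal lam)"

definition wweak :: "('a::euclidean_space \<Rightarrow> real) \<Rightarrow> real \<Rightarrow> ('a \<Rightarrow> real) \<Rightarrow> ennreal" where
  "wweak w r f = (SUP s\<in>{0<..}. ennreal (s powr (1 / r)) * wrearr w f s)"

text \<open>L^infinity norm (essential supremum w.r.t. Lebesgue measure); = L^{infinity,infinity}(w).\<close>
definition Linf :: "('a::euclidean_space \<Rightarrow> real) \<Rightarrow> ennreal" where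
  "Linf f = Inf {M. AE x in lebesgue. ennreal \<bar>f x\<bar> \<le> M}"

definition wLnorm :: "('a::euclidean_space \<Rightarrow> real) \<Rightarrow> real \<Rightarrow> ('a \<Rightarrow> real) \<Rightarrow> ennreal" where
  "wLnorm w r f =
     (let I = (\<integral>\<^sup>+ x. ennreal (\<bar>f x\<bar> powr r) \<partial>wmeas w)
      in if I = \<infinity> then \<infinity> else ennreal (enn2real I powr (1 / r)))"

text \<open>Properties (K1)-(K3) of the fundamental solution Gamma (plus its continuity for t > 0).\<close>
definition kernel_conds :: "('a::euclidean_space \<Rightarrow> real) \<Rightarrow> ('a \<Rightarrow> 'a \<Rightarrow> real \<Rightarrow> real) \<Rightarrow> bool" where
  "kernel_conds w \<Gamma> \<longleftrightarrow>
     continuous_on (UNIV \<times> UNIV \<times> {0<..}) (\<lambda>(x, y, t). \<Gamma> x y t) \<and>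
     (\<forall>x y t. 0 < t \<longrightarrow>
        (\<integral>\<^sup>+ \<xi>. ennreal (\<Gamma> \<xi> y t * w \<xi>) \<partial>lebesgue) = 1 \<and>
        (\<integral>\<^sup>+ \<eta>. ennreal (\<Gamma> x \<eta> t * w \<eta>) \<partial>lebesgue) = 1) \<and>
     (\<forall>x y t s. 0 < s \<and> s < t \<longrightarrow>
        ennreal (\<Gamma> x y t) = (\<integral>\<^sup>+ \<xi>. ennreal (\<Gamma> x \<xi> (t - s) * \<Gamma> \<xi> y s * w \<xi>) \<partial>lebesgue)) \<and>
     (\<exists>c C. 0 < c \<and> 0 < C \<and> (\<forall>x y t. 0 < t \<longrightarrow>
        c * exp (- (dist x y)\<^sup>2 / (c * t))
          \<le> sqrt (measure (wmeas w) (ball x (sqrt t)) * measure (wmeas w) (ball y (sqrt t))) * \<Gamma> x y t \<and>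
        sqrt (measure (wmeas w) (ball x (sqrt t)) * measure (wmeas w) (ball y (sqrt t))) * \<Gamma> x y t
          \<le> C * exp (- (dist x y)\<^sup>2 / (C * t))))"

text \<open>Solution of (P) on R^n x I (I = (0,T)): nonnegative, measurable, essentially bounded,
  satisfying the integral equation for every t in I and a.e. x (finiteness is automatic, u is real).\<close>
definition is_solution ::
  "('a::euclidean_space \<Rightarrow> real) \<Rightarrow> ('a \<Rightarrow> 'a \<Rightarrow> real \<Rightarrow> real) \<Rightarrow> real \<Rightarrow> ('a \<Rightarrow> real)
    \<Rightarrow> ('a \<Rightarrow> real \<Rightarrow> real) \<Rightarrow> real set \<Rightarrow> bool" where
  "is_solution w \<Gamma> p u0 u I \<longleftrightarrow>
     (\<forall>x. \<forall>t\<in>I. 0 \<le> u x t) \<and>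
     set_borel_measurable lebesgue (UNIV \<times> I) (\<lambda>z. u (fst z) (snd z)) \<and>
     (\<forall>t\<in>I. (\<lambda>x. u x t) \<in> borel_measurable lebesgue) \<and>
     (\<exists>M. AE z in lebesgue. z \<in> UNIV \<times> I \<longrightarrow> \<bar>u (fst z) (snd z)\<bar> \<le> M) \<and>
     (\<forall>t\<in>I. AE x in lebesgue.
        ennreal (u x t) =
          (\<integral>\<^sup>+ y. ennreal (\<Gamma> x y t * u0 y * w y) \<partial>lebesgue) +
          (\<integral>\<^sup>+ s\<in>{0<..<t}. (\<integral>\<^sup>+ y. ennreal (\<Gamma> x y (t - s) * u y s powr p * w y) \<partial>lebesgue) \<partial>lebesgue))"

definition global_solution ::
  "('a::euclidean_space \<Rightarrow> real) \<Rightarrow> ('a \<Rightarrow> 'a \<Rightarrow> real \<Rightarrow> real) \<Rightarrow> real \<Rightarrow> ('a \<Rightarrow> real)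
    \<Rightarrow> ('a \<Rightarrow> real \<Rightarrow> real) \<Rightarrow> bool" where
  "global_solution w \<Gamma> p u0 u \<longleftrightarrow> is_solution w \<Gamma> p u0 u {0<..}"

end

theory Submission
  imports Defs
begin

text \<open>
  Write \<open>N = n + \<alpha>\<close> and \<open>S t\<close> for the linear semigroup with kernel \<open>\<Gamma>\<close>. The weights satisfy
  \<open>w (B x \<rho>) \<ge> v \<rho>\<^sup>N\<close>, so the upper Gaussian bound yields \<open>\<Gamma> \<le> C t powr (- N / 2)\<close>. For \<open>k \<ge> 1\<close>
  the function \<open>2 (S t (u0\<^sup>k)) powr (1 / k)\<close> is a supersolution as soon as a bound \<open>G\<close> of the sup norm of
  \<open>S t (u0\<^sup>k)\<close> makes \<open>G t powr (1 - 1 / k)\<close> times the integral of \<open>G powr (p / k - 1)\<close> over \<open>(0, t)\<close>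
  at most \<open>2 powr (- p)\<close>. In the critical spaces (weak or strong, \<open>r = rs\<close>) this holds for small data
  and any \<open>1 < k < min p rs\<close>, because \<open>G\<close> is then a pure power of \<open>t\<close> and the product does not depend
  on \<open>t\<close>; for \<open>r < rs\<close> one takes \<open>k = 1\<close> and the minimum of the two bounds coming from the sup norm
  and the \<open>L\<^sup>r\<close> norm, the integral being controlled by exactly the product of norms in the
  hypothesis. Monotone iteration gives a solution below the supersolution, which carries the decay in
  sup norm and the bound in (weak) \<open>L\<^sup>r\<close>; interpolation gives all \<open>q \<ge> r\<close>. Uniqueness follows by
  iterating the difference estimate in the Duhamel formula.
\<close>

text \<open>In the critical case \<open>k = 1\<close> fails: \<open>G\<close> is then a multiple of
  \<open>t powr (- 1 / (p - 1))\<close>, and its power \<open>p - 1\<close> is a multiple of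
  \<open>1 / s\<close>, not integrable at 0 or at infinity. A power \<open>k > 1\<close> turns this
  into \<open>s powr (e - 1)\<close> with \<open>e = (k - 1) / (p - 1) > 0\<close>; the condition
  \<open>k < p\<close> keeps the exponent \<open>p / k - 1\<close> positive, so that the bound
  \<open>G\<close> may be inserted there, and \<open>k < rs\<close> leaves the datum's power in a
  weak space of exponent \<open>rs / k > 1\<close>, where cutting a function at a height gives all
  estimates. A second obstacle is measure-theoretic. Solutions are measurable for the completed
  product measure and bounded only almost everywhere, whereas Tonelli and the semigroup law run on
  Borel functions. The analysis is therefore done for everywhere bounded Borel functions, and data
  and solutions are replaced by clipped Borel representatives. The integral equation holds for every
  \<open>t\<close> and a.e. \<open>x\<close>, but a representative matches the solution only for
  a.e. \<open>t\<close>; the uniqueness argument carries both functions for this reason.\<close>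

section \<open>Elementary inequalities and one-dimensional integrals\<close>

text \<open>This is the tangent line of the concave map \<open>z powr (1 / k)\<close> at
  \<open>z = c powr k\<close>, evaluated at \<open>a powr k\<close>, with equality for
  \<open>a = c\<close>. Being affine in \<open>a powr k\<close>, it can be integrated against a
  probability kernel, which is how \<open>S_jensen\<close> uses it.\<close>

lemma young_tangent:
  fixes a c k :: real
  assumes "0 \<le> a" "0 < c" "1 \<le> k"
  shows "a \<le> c powr (1 - k) / k * a powr k + (1 - 1 / k) * c"
proof (cases "a = 0")
  case True
  then show ?thesis using assms by simp
next
  case False
  have "(c powr (1 - k) * a powr k) powr (1/k) * c powr (1 - 1/k)
      \<le> 1/k * (c powr (1 - k) * a powr k) + (1 - 1/k) * c"
    using assms False by (intro Youngs_inequality_0) auto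
  moreover have "(c powr (1 - k) * a powr k) powr (1/k) * c powr (1 - 1/k) = a"
  proof -
    have e: "(1 - k) * (1/k) + (1 - 1/k) = 0" using assms by (simp add: field_simps)
    have "(c powr (1 - k) * a powr k) powr (1/k) * c powr (1 - 1/k)
        = c powr ((1 - k) * (1/k) + (1 - 1/k)) * a powr (k * (1/k))"
      unfolding powr_mult powr_powr powr_add by (simp add: mult_ac)
    then show ?thesis unfolding e using assms False by simp
  qed
  ultimately show ?thesis by (simp add: mult_ac)
qed

text \<open>Mean value theorem on \<open>[b, a]\<close>, where the derivative is at most
  \<open>p * M powr (p - 1)\<close>. The form is one-sided: only \<open>a\<close> has to lie below
  \<open>M\<close>, so two solutions can be compared with a bound for just one of them.\<close>

lemma powr_le_powr_add_linear:
  fixes a b c M p :: real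
  assumes "0 \<le> a" "0 \<le> b" "a \<le> M" "a \<le> b + c" "0 \<le> c" "1 \<le> p"
  shows "a powr p \<le> b powr p + p * M powr (p - 1) * c"
proof (cases "a \<le> b")
  case True
  then have "a powr p \<le> b powr p" using assms by (intro powr_mono2) auto
  moreover have "0 \<le> p * M powr (p - 1) * c" using assms by simp
  ultimately show ?thesis by linarith
next
  case False
  have "a powr p \<le> b powr p + p * a powr (p - 1) * (a - b)"
  \<comment> \<open>The derivative formula for \<open>powr\<close> holds at positive arguments, so
    the interval starting at 0 is treated by hand.\<close>
  proof (cases "b = 0")
    case True
    have "a powr p = a powr (p - 1) * a" using False True assms
      by (simp add: powr_mult_base mult.commute)
    also have "\<dots> \<le> p * (a powr (p - 1) * a)"
      using assms mult_right_mono[of 1 p "a powr (p - 1) * a"] by simp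
    finally show ?thesis using True by (simp add: mult_ac)
  next
    case b: False
    have "\<exists>z. b < z \<and> z < a \<and> a powr p - b powr p = (a - b) * (p * z powr (p - 1))"
      using False b assms by (intro MVT2) (auto intro!: derivative_eq_intros)
    then obtain z where z: "b < z" "z < a" "a powr p - b powr p = (a - b) * (p * z powr (p - 1))"
      by blast
    have "z powr (p - 1) \<le> a powr (p - 1)" using z assms by (intro powr_mono2) auto
    then have "(a - b) * (p * z powr (p - 1)) \<le> (a - b) * (p * a powr (p - 1))"
      using False assms by (intro mult_left_mono) auto
    then show ?thesis using z by (simp add: mult_ac)
  qed
  also have "p * a powr (p - 1) * (a - b) \<le> p * M powr (p - 1) * c"
    using assms False by (intro mult_mono powr_mono2) auto
  finally show ?thesis by simp
qed

lemma ennreal_powr_SUP: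
  fixes X :: "nat \<Rightarrow> real"
  assumes "incseq X" "X \<longlonglongrightarrow> l" "\<And>n. 0 \<le> X n" "0 < p"
  shows "(SUP n. ennreal (X n powr p)) = ennreal (l powr p)"
proof (rule LIMSEQ_unique[OF LIMSEQ_SUP])
  show "incseq (\<lambda>n. ennreal (X n powr p))"
    using assms by (auto simp: incseq_def intro!: ennreal_leI powr_mono2)
  show "(\<lambda>n. ennreal (X n powr p)) \<longlonglongrightarrow> ennreal (l powr p)"
    using assms by (intro tendsto_ennrealI tendsto_powr' tendsto_const) auto
qed

lemma nn_integral_powr_atLeast:
  assumes "1 < m" "0 < l"
  shows "(\<integral>\<^sup>+\<tau>. ennreal (\<tau> powr (- m)) * indicator {l..} \<tau> \<partial>lborel) = ennreal (l powr (1 - m) / (m - 1))"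
proof -
  have "((\<lambda>\<tau>. \<tau> powr (- m)) has_integral - (l powr (- m + 1)) / (- m + 1)) {l..}"
    using assms by (intro has_integral_powr_to_inf) auto
  also have "- (l powr (- m + 1)) / (- m + 1) = l powr (1 - m) / (m - 1)"
    using minus_divide_divide[of "l powr (1 - m)" "m - 1"] by simp
  finally have "(\<integral>\<^sup>+\<tau>. ennreal (if \<tau> \<in> {l..} then \<tau> powr (- m) else 0) \<partial>lborel) = ennreal (l powr (1 - m) / (m - 1))"
    by (intro nn_integral_has_integral_lborel) (auto simp only: has_integral_restrict_UNIV, auto)
  moreover have "ennreal (if \<tau> \<in> {l..} then \<tau> powr (- m) else 0) = ennreal (\<tau> powr (- m)) * indicator {l..} \<tau>" for \<tau>
    by simp
  ultimately show ?thesis by simp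
qed

lemma nn_integral_powr_from_0:
  fixes e t :: real
  assumes "0 < e" "0 < t"
  shows "(\<integral>\<^sup>+s\<in>{0<..<t}. ennreal (s powr (e - 1)) \<partial>lborel) = ennreal (t powr e / e)"
proof -
  have "((\<lambda>s. s powr (e - 1)) has_integral (t powr (e - 1 + 1) / (e - 1 + 1))) {0..t}"
    using assms by (intro has_integral_powr_from_0) auto
  then have "(\<integral>\<^sup>+s. ennreal (if s \<in> {0..t} then s powr (e - 1) else 0) \<partial>lborel) = ennreal (t powr (e - 1 + 1) / (e - 1 + 1))"
    by (intro nn_integral_has_integral_lborel) (auto simp only: has_integral_restrict_UNIV, auto)
  moreover have "(\<integral>\<^sup>+s\<in>{0<..<t}. ennreal (s powr (e - 1)) \<partial>lborel)
      = (\<integral>\<^sup>+s. ennreal (if s \<in> {0..t} then s powr (e - 1) else 0) \<partial>lborel)"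
  proof (rule nn_integral_cong_AE)
    show "AE s in lborel. ennreal (s powr (e - 1)) * indicator {0<..<t} s
        = ennreal (if s \<in> {0..t} then s powr (e - 1) else 0)"
      using AE_lborel_singleton[of 0] AE_lborel_singleton[of t]
      by eventually_elim auto
  qed
  ultimately show ?thesis by simp
qed

text \<open>Use \<open>1 + t \<le> 2\<close> for \<open>t \<le> 1\<close> and
  \<open>1 + t \<le> 2 * t\<close> afterwards; either way only the factor
  \<open>2 powr \<beta>\<close> is lost. The summand 1 and the absolute values make \<open>D\<close>
  positive whatever the signs of \<open>D0\<close> and \<open>D1\<close>.\<close>

lemma decay_combine:
  fixes g :: "real \<Rightarrow> 'a \<Rightarrow> real"
  assumes \<beta>: "0 \<le> \<beta>" and "\<And>t x. 0 < t \<Longrightarrow> g t x \<le> D0" "\<And>t x. 0 < t \<Longrightarrow> g t x \<le> D1 * t powr (- \<beta>)"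
  shows "\<exists>D>0. \<forall>t>0. \<forall>x. g t x \<le> D * (1 + t) powr (- \<beta>)"
proof (intro exI conjI allI impI)
  define D where "D = 2 powr \<beta> * (1 + \<bar>D0\<bar> + \<bar>D1\<bar>)"
  show "0 < D" unfolding D_def by (intro mult_pos_pos) auto
  fix t :: real and x assume t: "0 < t"
  show "g t x \<le> D * (1 + t) powr (- \<beta>)"
  proof (cases "t \<le> 1")
    case True
    have "2 powr (- \<beta>) \<le> (1 + t) powr (- \<beta>)" using t True \<beta> by (intro powr_mono2') auto
    then have "D * 2 powr (- \<beta>) \<le> D * (1 + t) powr (- \<beta>)"
      using \<open>0 < D\<close> by (intro mult_left_mono) auto
    moreover have "D * 2 powr (- \<beta>) = 1 + \<bar>D0\<bar> + \<bar>D1\<bar>"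
      unfolding D_def by (simp add: powr_minus)
    ultimately show ?thesis using assms(2)[OF t, of x] by linarith
  next
    case False
    have "g t x \<le> (1 + \<bar>D0\<bar> + \<bar>D1\<bar>) * t powr (- \<beta>)"
      by (rule order_trans[OF assms(3)[OF t]]) (intro mult_right_mono, auto)
    also have "\<dots> = D * (2 * t) powr (- \<beta>)"
      unfolding D_def by (simp add: powr_minus powr_mult)
    also have "\<dots> \<le> D * (1 + t) powr (- \<beta>)"
      using \<open>0 < D\<close> False \<beta> by (intro mult_left_mono powr_mono2') auto
    finally show ?thesis .
  qed
qed

subsection \<open>Mild solutions for an abstract heat kernel\<close>

text \<open>Since \<open>K\<close> vanishes for \<open>t \<le> 0\<close>, integrals of \<open>K (t - s)\<close> over all \<open>s > 0\<close> only see
  \<open>s < t\<close>.\<close>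

locale heat_kernel = sigma_finite_measure \<mu>
  for \<mu> :: "'a::euclidean_space measure" +
  fixes K :: "real \<Rightarrow> 'a \<Rightarrow> 'a \<Rightarrow> ennreal" and C N :: real
  assumes sets_mu [measurable_cong]: "sets \<mu> = sets borel"
    and kernel_measurable:
      "(\<lambda>(t, x, y). K t x y) \<in> borel_measurable (borel \<Otimes>\<^sub>M borel \<Otimes>\<^sub>M borel)"
    and mass_right: "\<And>t x. 0 < t \<Longrightarrow> (\<integral>\<^sup>+y. K t x y \<partial>\<mu>) = 1"
    and mass_left: "\<And>t y. 0 < t \<Longrightarrow> (\<integral>\<^sup>+x. K t x y \<partial>\<mu>) = 1"
    and kernel_add: "\<And>s t x y. 0 < s \<Longrightarrow> 0 < t \<Longrightarrow> K (s + t) x y = (\<integral>\<^sup>+z. K s x z * K t z y \<partial>\<mu>)"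
    and kernel_le: "\<And>t x y. 0 < t \<Longrightarrow> K t x y \<le> ennreal (C * t powr (- (N / 2)))"
    and kernel_nonpos: "\<And>t x y. t \<le> 0 \<Longrightarrow> K t x y = 0"
    and C_pos: "0 < C" and N_pos: "0 < N"
    and AE_mu: "\<And>P. (AE x in lborel. P x) \<Longrightarrow> (AE x in \<mu>. P x)"
begin

lemma K_measurable [measurable (raw)]:
  assumes [measurable]: "g \<in> borel_measurable M" "h \<in> M \<rightarrow>\<^sub>M borel" "h' \<in> M \<rightarrow>\<^sub>M borel"
  shows "(\<lambda>\<omega>. K (g \<omega>) (h \<omega>) (h' \<omega>)) \<in> borel_measurable M"
proof -
  have "(\<lambda>\<omega>. (\<lambda>(t, x, y). K t x y) (g \<omega>, h \<omega>, h' \<omega>)) \<in> borel_measurable M"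
    by (rule measurable_compose[OF _ kernel_measurable]) measurable
  then show ?thesis by simp
qed

section \<open>The linear semigroup and Jensen's inequality\<close>

definition S :: "real \<Rightarrow> ('a \<Rightarrow> ennreal) \<Rightarrow> 'a \<Rightarrow> ennreal" where
  "S t F x = (\<integral>\<^sup>+y. K t x y * F y \<partial>\<mu>)"

text \<open>The datum \<open>F\<close> may depend on the parameter as well: in the Duhamel term the
  semigroup acts on \<open>u s\<close> while \<open>s\<close> is being integrated.\<close>

lemma S_measurable [measurable (raw)]:
  assumes [measurable]: "g \<in> borel_measurable M" "h \<in> M \<rightarrow>\<^sub>M borel"
    and F: "(\<lambda>(\<omega>, y). F \<omega> y) \<in> borel_measurable (M \<Otimes>\<^sub>M borel)"
  shows "(\<lambda>\<omega>. S (g \<omega>) (F \<omega>) (h \<omega>)) \<in> borel_measurable M"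
proof -
  have [measurable]: "(\<lambda>(\<omega>, y). F \<omega> y) \<in> borel_measurable (M \<Otimes>\<^sub>M \<mu>)"
    using F measurable_cong_sets[OF sets_pair_measure_cong[OF refl sets_mu, of M] refl] by simp
  show ?thesis unfolding S_def by measurable
qed

lemma S_mono: "(\<And>y. F y \<le> F' y) \<Longrightarrow> S t F x \<le> S t F' x"
  unfolding S_def by (intro nn_integral_mono mult_left_mono) auto

lemma S_mono_AE: "(AE y in lborel. F y \<le> F' y) \<Longrightarrow> S t F x \<le> S t F' x"
  unfolding S_def by (intro nn_integral_mono_AE) (drule AE_mu, auto elim!: eventually_mono intro: mult_left_mono)

lemma S_const: "0 < t \<Longrightarrow> S t (\<lambda>_. c) x = c"
  unfolding S_def by (subst nn_integral_multc) (auto simp: mass_right)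

lemma S_nonpos: "t \<le> 0 \<Longrightarrow> S t F x = 0"
  unfolding S_def by (simp add: kernel_nonpos)

lemma S_cmult: "F \<in> borel_measurable borel \<Longrightarrow> S t (\<lambda>y. c * F y) x = c * S t F x"
  unfolding S_def
  by (subst nn_integral_cmult[symmetric]) (auto simp: mult_ac)

lemma S_add: "F \<in> borel_measurable borel \<Longrightarrow> G \<in> borel_measurable borel \<Longrightarrow>
    S t (\<lambda>y. F y + G y) x = S t F x + S t G x"
  unfolding S_def by (subst nn_integral_add[symmetric]) (auto simp: distrib_left)

text \<open>Tonelli applied to \<open>kernel_add\<close>; with values in \<open>ennreal\<close> the
  exchange of integrals carries no integrability conditions.\<close>

lemma S_semigroup:
  assumes [measurable]: "F \<in> borel_measurable borel" and "0 < s" "0 < t"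
  shows "S s (S t F) x = S (s + t) F x"
proof -
  interpret pair_sigma_finite \<mu> \<mu> ..
  have "S s (S t F) x = (\<integral>\<^sup>+y. (\<integral>\<^sup>+z. K s x y * (K t y z * F z) \<partial>\<mu>) \<partial>\<mu>)"
    unfolding S_def by (subst nn_integral_cmult) auto
  also have "\<dots> = (\<integral>\<^sup>+z. (\<integral>\<^sup>+y. K s x y * (K t y z * F z) \<partial>\<mu>) \<partial>\<mu>)"
    by (subst Fubini') auto
  also have "\<dots> = (\<integral>\<^sup>+z. (\<integral>\<^sup>+y. K s x y * K t y z \<partial>\<mu>) * F z \<partial>\<mu>)"
    by (subst nn_integral_multc[symmetric]) (auto simp: mult_ac)
  finally show ?thesis by (simp add: kernel_add[OF assms(2,3)] S_def)
qed

lemma nn_integral_S: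
  assumes [measurable]: "F \<in> borel_measurable borel" and "0 < t"
  shows "(\<integral>\<^sup>+x. S t F x \<partial>\<mu>) = (\<integral>\<^sup>+x. F x \<partial>\<mu>)"
proof -
  interpret pair_sigma_finite \<mu> \<mu> ..
  have "(\<integral>\<^sup>+x. S t F x \<partial>\<mu>) = (\<integral>\<^sup>+y. (\<integral>\<^sup>+x. K t x y * F y \<partial>\<mu>) \<partial>\<mu>)"
    unfolding S_def by (subst Fubini') auto
  also have "\<dots> = (\<integral>\<^sup>+y. (\<integral>\<^sup>+x. K t x y \<partial>\<mu>) * F y \<partial>\<mu>)"
    by (subst nn_integral_multc) auto
  finally show ?thesis using assms by (simp add: mass_left)
qed

lemma S_le_nn_integral:
  assumes [measurable]: "F \<in> borel_measurable borel" and "0 < t"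
  shows "S t F x \<le> ennreal (C * t powr (- (N / 2))) * (\<integral>\<^sup>+y. F y \<partial>\<mu>)"
proof -
  have "S t F x \<le> (\<integral>\<^sup>+y. ennreal (C * t powr (- (N / 2))) * F y \<partial>\<mu>)"
    unfolding S_def by (intro nn_integral_mono mult_right_mono kernel_le assms) auto
  then show ?thesis by (subst (asm) nn_integral_cmult) auto
qed

lemma S_le_const:
  assumes "0 < t" "\<And>y. F y \<le> c"
  shows "S t F x \<le> c"
  using S_mono[of F "\<lambda>_. c" t x] assms by (simp add: S_const)

text \<open>Integrating \<open>young_tangent\<close> against the kernel, which has mass 1, gives for
  each \<open>c > 0\<close> a bound affine in \<open>A\<close>, the value of the semigroup on
  \<open>f powr k\<close>; the claim is the best choice of \<open>c\<close>. Finiteness is assumed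
  because \<open>enn2real\<close> sends infinity to 0.\<close>

lemma S_jensen:
  fixes f :: "'a \<Rightarrow> real"
  assumes [measurable]: "f \<in> borel_measurable borel" and f: "\<And>x. 0 \<le> f x" and k: "1 \<le> k"
    and t: "0 < t" and fin: "S t (\<lambda>y. ennreal (f y powr k)) x < \<infinity>"
  shows "S t (\<lambda>y. ennreal (f y)) x \<le> ennreal (enn2real (S t (\<lambda>y. ennreal (f y powr k)) x) powr (1 / k))"
proof -
  obtain A where A: "0 \<le> A" "S t (\<lambda>y. ennreal (f y powr k)) x = ennreal A"
    using fin by (metis ennreal_enn2real enn2real_nonneg infinity_ennreal_def)
  have bound: "S t (\<lambda>y. ennreal (f y)) x \<le> ennreal (c powr (1 - k) / k * A + (1 - 1 / k) * c)" if "0 < c" for c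
  proof -
    have "S t (\<lambda>y. ennreal (f y)) x
        \<le> S t (\<lambda>y. ennreal (c powr (1 - k) / k) * ennreal (f y powr k) + ennreal ((1 - 1 / k) * c)) x"
    proof (rule S_mono)
      fix y
      have "ennreal (f y) \<le> ennreal (c powr (1 - k) / k * f y powr k + (1 - 1 / k) * c)"
        by (intro ennreal_leI young_tangent f that k)
      then show "ennreal (f y) \<le> ennreal (c powr (1 - k) / k) * ennreal (f y powr k) + ennreal ((1 - 1 / k) * c)"
        using that k f[of y]
        by (subst ennreal_mult[symmetric], simp, simp, subst ennreal_plus[symmetric]) auto
    qed
    also have "\<dots> = ennreal (c powr (1 - k) / k) * ennreal A + ennreal ((1 - 1 / k) * c)"
      using t by (subst S_add, simp, simp, subst S_cmult) (auto simp: S_const A(2)[symmetric])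
    also have "\<dots> = ennreal (c powr (1 - k) / k * A + (1 - 1 / k) * c)"
      using that k A
      by (subst ennreal_mult[symmetric], simp, simp, subst ennreal_plus[symmetric]) auto
    finally show ?thesis .
  qed
  show ?thesis
  proof (cases "A = 0")
    case True
    \<comment> \<open>The optimal \<open>c\<close> would be 0, which is not admissible, so
      arbitrarily small positive values are used.\<close>
    have "S t (\<lambda>y. ennreal (f y)) x \<le> 0 + ennreal e" if "0 < e" for e
    proof -
      have "(1 - 1 / k) * e \<le> e" using k that by (simp add: field_simps)
      then show ?thesis using bound[OF that] True by (auto intro: order_trans ennreal_leI)
    qed
    then have "S t (\<lambda>y. ennreal (f y)) x \<le> 0" by (rule ennreal_le_epsilon)
    then show ?thesis by simp
  next
    case False
    \<comment> \<open>The minimiser over \<open>c\<close> of the bound is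
      \<open>c = A powr (1 / k)\<close>, and the minimum has the same value.\<close>
    have "(A powr (1 / k)) powr (1 - k) * A = A powr (1 / k)"
    proof -
      have "(A powr (1 / k)) powr (1 - k) * A powr 1 = A powr (1 / k * (1 - k) + 1)"
        unfolding powr_powr powr_add ..
      also have "1 / k * (1 - k) + 1 = 1 / k" using k by (simp add: field_simps)
      finally show ?thesis using A by simp
    qed
    then have "(A powr (1 / k)) powr (1 - k) / k * A + (1 - 1 / k) * A powr (1 / k) = A powr (1 / k)"
      by (simp add: field_simps)
    moreover have "0 < A powr (1 / k)" using A False by simp
    note bound[OF this]
    ultimately show ?thesis unfolding A(2) enn2real_ennreal[OF A(1)] by (simp only:)
  qed
qed

section \<open>The Duhamel term, supersolutions and monotone iteration\<close>

text \<open>A domain of integration independent of \<open>t\<close> makes joint measurability in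
  \<open>(t, x)\<close> a matter of composition; the cut-off \<open>s < t\<close> is left to the
  kernel.\<close>

definition duhamel :: "real \<Rightarrow> (real \<Rightarrow> 'a \<Rightarrow> real) \<Rightarrow> real \<Rightarrow> 'a \<Rightarrow> ennreal" where
  "duhamel p u t x = (\<integral>\<^sup>+s\<in>{0<..}. S (t - s) (\<lambda>y. ennreal (u s y powr p)) x \<partial>lborel)"

lemma duhamel_measurable [measurable]:
  assumes [measurable]: "case_prod u \<in> borel_measurable (borel \<Otimes>\<^sub>M borel)"
  shows "case_prod (duhamel p u) \<in> borel_measurable (borel \<Otimes>\<^sub>M borel)"
  unfolding duhamel_def by measurable

lemma duhamel_mono:
  assumes "\<And>s y. 0 < s \<Longrightarrow> 0 \<le> u s y" "\<And>s y. 0 < s \<Longrightarrow> u s y \<le> v s y" "0 \<le> p"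
  shows "duhamel p u t x \<le> duhamel p v t x"
  unfolding duhamel_def
  by (intro nn_integral_mono) (auto simp: indicator_def assms intro!: S_mono ennreal_leI powr_mono2)

text \<open>For \<open>k \<ge> 1\<close> Jensen's inequality gives \<open>S t f \<le> profile k f t\<close>; the supersolution is
  twice the profile.\<close>

definition profile :: "real \<Rightarrow> ('a \<Rightarrow> real) \<Rightarrow> real \<Rightarrow> 'a \<Rightarrow> real" where
  "profile k f t x = enn2real (S t (\<lambda>y. ennreal (f y powr k)) x) powr (1 / k)"

lemma profile_measurable [measurable]:
  assumes [measurable]: "f \<in> borel_measurable borel"
  shows "case_prod (profile k f) \<in> borel_measurable (borel \<Otimes>\<^sub>M borel)"
  unfolding profile_def by measurable

lemma S_powr_le:
  assumes "\<And>x. 0 \<le> f x" "\<And>x. f x \<le> B" "0 \<le> k" "0 < t"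
  shows "S t (\<lambda>y. ennreal (f y powr k)) x \<le> ennreal (B powr k)"
  using assms by (intro S_le_const ennreal_leI powr_mono2) auto

lemma profile_le:
  assumes "\<And>x. 0 \<le> f x" "\<And>x. f x \<le> B" "1 \<le> k" "0 < t"
  shows "profile k f t x \<le> B"
proof -
  have B: "0 \<le> B" using assms(1,2) order_trans by blast
  have "enn2real (S t (\<lambda>y. ennreal (f y powr k)) x) \<le> B powr k"
    using S_powr_le[of f B k t x] assms B by (intro enn2real_leI) auto
  then have "profile k f t x \<le> (B powr k) powr (1 / k)"
    unfolding profile_def using assms by (intro powr_mono2) auto
  then show ?thesis using B assms by (simp add: powr_powr)
qed

text \<open>Let \<open>A s\<close> be the semigroup applied to \<open>f powr k\<close>. Splitting
  off one factor, \<open>A s powr (p / k)\<close> is at most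
  \<open>G s powr (p / k - 1) * A s\<close>, and \<open>S (t - s)\<close> maps \<open>A s\<close> to
  \<open>A t\<close>. The Duhamel term is thus at most \<open>2 powr p\<close> times the integral of
  \<open>G powr (p / k - 1)\<close> times \<open>A t\<close>, and \<open>A t\<close> is at most
  \<open>G t powr (1 - 1 / k)\<close> times the profile. Smallness reduces the product to one
  profile; Jensen's inequality bounds the linear term by the other.\<close>

lemma supersolution:
  assumes [measurable]: "f \<in> borel_measurable borel" "G \<in> borel_measurable borel"
    and f: "\<And>x. 0 \<le> f x" "\<And>x. f x \<le> B" and k: "1 \<le> k" "k < p"
    and G0: "\<And>t. 0 < t \<Longrightarrow> 0 \<le> G t"
    and G: "\<And>t x. 0 < t \<Longrightarrow> S t (\<lambda>y. ennreal (f y powr k)) x \<le> ennreal (G t)"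
    and small: "\<And>t. 0 < t \<Longrightarrow> ennreal (G t powr (1 - 1 / k)) * (\<integral>\<^sup>+s\<in>{0<..<t}. ennreal (G s powr (p / k - 1)) \<partial>lborel)
        \<le> ennreal (2 powr (- p))"
    and t: "0 < t"
  shows "S t (\<lambda>y. ennreal (f y)) x + duhamel p (\<lambda>s y. 2 * profile k f s y) t x
      \<le> ennreal (2 * profile k f t x)"
proof -
  define A where "A s y = enn2real (S s (\<lambda>y. ennreal (f y powr k)) y)" for s y
  have A_eq: "S s (\<lambda>y. ennreal (f y powr k)) y = ennreal (A s y)" if "0 < s" for s y
    using S_powr_le[of f B k s y] f k that unfolding A_def
    by (subst ennreal_enn2real) (auto simp: top_unique less_top[symmetric] intro: le_less_trans)
  have A0: "0 \<le> A s y" for s y unfolding A_def by simp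
  have AG: "A s y \<le> G s" if "0 < s" for s y
    using G[OF that, of y] G0[OF that] by (simp add: A_eq[OF that])
  have [measurable]: "case_prod A \<in> borel_measurable (borel \<Otimes>\<^sub>M borel)"
    unfolding A_def by measurable
  have prof: "profile k f s y = A s y powr (1 / k)" for s y
    unfolding profile_def A_def ..
  have inner: "S (t - s) (\<lambda>y. ennreal ((2 * profile k f s y) powr p)) x
      \<le> ennreal (2 powr p) * (ennreal (G s powr (p / k - 1)) * indicator {..<t} s) * ennreal (A t x)"
    if s: "0 < s" for s
  proof (cases "s < t")
    case False
    then show ?thesis by (simp add: S_nonpos)
  next
    case True
    have "(2 * profile k f s y) powr p \<le> 2 powr p * (G s powr (p / k - 1) * A s y)" for y
    proof -
      have "(2 * profile k f s y) powr p = 2 powr p * A s y powr (p / k)"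
        unfolding prof powr_mult powr_powr by simp
      also have "A s y powr (p / k) = A s y powr (p / k - 1) * A s y"
        using A0[of s y] by (cases "A s y = 0") (auto simp: powr_diff)
      also have "\<dots> \<le> G s powr (p / k - 1) * A s y"
        using A0[of s y] AG[OF s, of y] k by (intro mult_right_mono powr_mono2) auto
      finally show ?thesis by simp
    qed
    then have "S (t - s) (\<lambda>y. ennreal ((2 * profile k f s y) powr p)) x
        \<le> S (t - s) (\<lambda>y. ennreal (2 powr p * G s powr (p / k - 1)) * ennreal (A s y)) x"
      using A0 by (intro S_mono) (auto simp: ennreal_mult[symmetric] mult_ac intro!: ennreal_leI)
    also have "\<dots> = ennreal (2 powr p * G s powr (p / k - 1)) * S (t - s) (\<lambda>y. ennreal (A s y)) x"
      by (rule S_cmult) measurable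
    \<comment> \<open>Since \<open>A s\<close> is itself an evolved function, the semigroup law
      removes \<open>s\<close> from every factor except the power of \<open>G\<close>.\<close>
    also have "(\<lambda>y. ennreal (A s y)) = S s (\<lambda>y. ennreal (f y powr k))"
      using A_eq[OF s] by auto
    also have "S (t - s) (S s (\<lambda>y. ennreal (f y powr k))) x = ennreal (A t x)"
      using True s t by (subst S_semigroup) (auto simp: A_eq)
    finally show ?thesis using True by (simp add: ennreal_mult)
  qed
  have "duhamel p (\<lambda>s y. 2 * profile k f s y) t x
      \<le> (\<integral>\<^sup>+s. ennreal (2 powr p) * (ennreal (G s powr (p / k - 1)) * indicator {0<..<t} s) * ennreal (A t x) \<partial>lborel)"
    unfolding duhamel_def using inner
    by (intro nn_integral_mono) (auto simp: indicator_def split: if_splits)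
  also have "\<dots> = ennreal (2 powr p) * (\<integral>\<^sup>+s\<in>{0<..<t}. ennreal (G s powr (p / k - 1)) \<partial>lborel) * ennreal (A t x)"
    by (subst nn_integral_multc, simp, subst nn_integral_cmult, auto)
  also have "\<dots> \<le> ennreal (2 powr p) * (\<integral>\<^sup>+s\<in>{0<..<t}. ennreal (G s powr (p / k - 1)) \<partial>lborel)
       * (ennreal (G t powr (1 - 1 / k)) * ennreal (profile k f t x))"
  proof (intro mult_left_mono)
    have "A t x \<le> G t powr (1 - 1 / k) * profile k f t x"
    proof (cases "A t x = 0")
      case True then show ?thesis by (simp add: prof)
    next
      case False
      then have "A t x = A t x powr (1 - 1 / k) * A t x powr (1 / k)"
        using A0[of t x] by (simp add: powr_add[symmetric])
      also have "\<dots> \<le> G t powr (1 - 1 / k) * A t x powr (1 / k)"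
        using A0[of t x] AG[OF t, of x] k by (intro mult_right_mono powr_mono2) auto
      finally show ?thesis by (simp add: prof)
    qed
    then show "ennreal (A t x) \<le> ennreal (G t powr (1 - 1 / k)) * ennreal (profile k f t x)"
      by (simp add: ennreal_mult[symmetric] prof ennreal_leI)
  qed auto
  also have "\<dots> = ennreal (2 powr p) * (ennreal (G t powr (1 - 1 / k)) * (\<integral>\<^sup>+s\<in>{0<..<t}. ennreal (G s powr (p / k - 1)) \<partial>lborel))
       * ennreal (profile k f t x)"
    by (simp add: mult_ac)
  also have "\<dots> \<le> ennreal (2 powr p) * ennreal (2 powr (- p)) * ennreal (profile k f t x)"
    by (intro mult_right_mono mult_left_mono small t) auto
  also have "\<dots> = ennreal (profile k f t x)"
    by (simp add: ennreal_mult[symmetric] powr_add[symmetric] prof)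
  finally have "duhamel p (\<lambda>s y. 2 * profile k f s y) t x \<le> ennreal (profile k f t x)" .
  moreover have "S t (\<lambda>y. ennreal (f y)) x \<le> ennreal (profile k f t x)"
    unfolding profile_def using S_powr_le[of f B k t x] f k t
    by (intro S_jensen) (auto intro: le_less_trans)
  ultimately have "S t (\<lambda>y. ennreal (f y)) x + duhamel p (\<lambda>s y. 2 * profile k f s y) t x
      \<le> ennreal (profile k f t x) + ennreal (profile k f t x)" by (intro add_mono)
  then show ?thesis by (simp add: ennreal_plus[symmetric] prof del: ennreal_plus)
qed

text \<open>Monotone convergence twice: in \<open>y\<close> inside the semigroup, then in
  \<open>s\<close>.\<close>

lemma duhamel_SUP:
  assumes [measurable]: "\<And>n. case_prod (u n) \<in> borel_measurable (borel \<Otimes>\<^sub>M borel)"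
    and inc: "\<And>s y. incseq (\<lambda>n. u n s y)" and u0: "\<And>n s y. 0 \<le> u n s y"
    and lim: "\<And>s y. (\<lambda>n. u n s y) \<longlonglongrightarrow> v s y" and p: "0 < p"
  shows "(SUP n. duhamel p (u n) t x) = duhamel p v t x"
proof -
  have inc': "u m s y powr p \<le> u n s y powr p" if "m \<le> n" for m n s y
    using inc[of s y] that u0 p by (intro powr_mono2) (auto simp: incseq_def)
  have inner: "(SUP n. S (t - s) (\<lambda>y. ennreal (u n s y powr p)) x) = S (t - s) (\<lambda>y. ennreal (v s y powr p)) x" for s
  proof -
    have "S (t - s) (\<lambda>y. ennreal (v s y powr p)) x = (\<integral>\<^sup>+y. (SUP n. K (t - s) x y * ennreal (u n s y powr p)) \<partial>\<mu>)"
      unfolding S_def using u0 p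
      by (intro nn_integral_cong) (simp add: SUP_mult_left_ennreal[symmetric] ennreal_powr_SUP[OF inc lim])
    also have "\<dots> = (SUP n. S (t - s) (\<lambda>y. ennreal (u n s y powr p)) x)"
      unfolding S_def
      by (intro nn_integral_monotone_convergence_SUP)
         (auto simp: incseq_def le_fun_def intro!: mult_left_mono ennreal_leI inc')
    finally show ?thesis by simp
  qed
  have "duhamel p v t x = (\<integral>\<^sup>+s. (SUP n. S (t - s) (\<lambda>y. ennreal (u n s y powr p)) x * indicator {0<..} s) \<partial>lborel)"
    unfolding duhamel_def inner[symmetric] by (simp add: SUP_mult_right_ennreal)
  also have "\<dots> = (SUP n. duhamel p (u n) t x)"
    unfolding duhamel_def
    by (intro nn_integral_monotone_convergence_SUP)
       (auto simp: incseq_def le_fun_def intro!: mult_right_mono S_mono ennreal_leI inc')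
  finally show ?thesis by simp
qed

lemma duhamel_nonpos: "t \<le> 0 \<Longrightarrow> duhamel p u t x = 0"
proof -
  assume "t \<le> 0"
  then have "S (t - s) F x * indicator {0<..} s = 0" for s F
    by (cases "0 < s") (auto simp: S_nonpos)
  then show ?thesis unfolding duhamel_def by (simp only: nn_integral_const mult_zero_left)
qed

text \<open>The iterates start from 0, increase, and stay below the supersolution, so their
  pointwise limit is finite. The equation is obtained at every point; for \<open>t \<le> 0\<close>
  both sides vanish, which spares all inductions a side condition on time.\<close>

lemma mild_solution_exists:
  assumes [measurable]: "f \<in> borel_measurable borel" "G \<in> borel_measurable borel"
    and f: "\<And>x. 0 \<le> f x" "\<And>x. f x \<le> B" and k: "1 \<le> k" "k < p"
    and G0: "\<And>t. 0 < t \<Longrightarrow> 0 \<le> G t"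
    and G: "\<And>t x. 0 < t \<Longrightarrow> S t (\<lambda>y. ennreal (f y powr k)) x \<le> ennreal (G t)"
    and small: "\<And>t. 0 < t \<Longrightarrow> ennreal (G t powr (1 - 1 / k)) * (\<integral>\<^sup>+s\<in>{0<..<t}. ennreal (G s powr (p / k - 1)) \<partial>lborel)
        \<le> ennreal (2 powr (- p))"
  shows "\<exists>u. case_prod u \<in> borel_measurable (borel \<Otimes>\<^sub>M borel) \<and> (\<forall>t x. 0 \<le> u t x) \<and>
    (\<forall>t x. u t x \<le> 2 * profile k f t x) \<and>
    (\<forall>t x. ennreal (u t x) = S t (\<lambda>y. ennreal (f y)) x + duhamel p u t x)"
proof -
  define \<Phi> where "\<Phi> u t x = S t (\<lambda>y. ennreal (f y)) x + duhamel p u t x" for u t x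
  define V where "V t x = 2 * profile k f t x" for t x
  have V0: "0 \<le> V t x" for t x unfolding V_def profile_def by simp
  have \<Phi>V: "\<Phi> V t x \<le> ennreal (V t x)" for t x
  proof (cases "0 < t")
    case True
    then show ?thesis using supersolution[OF assms(1,2) f k G0 G small True, of x]
      unfolding V_def \<Phi>_def by simp
  next
    case False
    then show ?thesis using V0 by (simp add: \<Phi>_def S_nonpos duhamel_nonpos)
  qed
  \<comment> \<open>The iterates are real-valued, so each step passes through
    \<open>enn2real\<close>; \<open>U_eq\<close> shows that nothing is lost, the supersolution
    keeping the value finite.\<close>
  define U where "U = rec_nat (\<lambda>t x. 0 :: real) (\<lambda>n v t x. enn2real (\<Phi> v t x))"
  have U_0: "U 0 = (\<lambda>t x. 0)" and U_Suc: "U (Suc n) = (\<lambda>t x. enn2real (\<Phi> (U n) t x))" for n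
    unfolding U_def by simp_all
  have U_meas [measurable]: "case_prod (U n) \<in> borel_measurable (borel \<Otimes>\<^sub>M borel)" for n
  proof (induction n)
    case 0 then show ?case unfolding U_0 by measurable
  next
    case (Suc n)
    note [measurable] = this
    have [measurable]: "case_prod (duhamel p (U n)) \<in> borel_measurable (borel \<Otimes>\<^sub>M borel)"
      by measurable
    show ?case unfolding U_Suc \<Phi>_def by measurable
  qed
  have nonneg: "0 \<le> U n t x" for n t x
    by (cases n) (simp_all add: U_0 U_Suc)
  have \<Phi>_mono: "\<Phi> u t x \<le> \<Phi> v t x" if "\<And>s y. 0 \<le> u s y" "\<And>s y. u s y \<le> v s y" for u v t x
    unfolding \<Phi>_def using that k by (intro add_mono duhamel_mono) auto
  have UV: "U n t x \<le> V t x" for n t x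
  proof (induction n arbitrary: t x)
    case 0 then show ?case using V0 by (simp add: U_0)
  next
    case (Suc n)
    have "\<Phi> (U n) t x \<le> ennreal (V t x)"
      by (rule order_trans[OF \<Phi>_mono \<Phi>V]) (use Suc nonneg in auto)
    then show ?case unfolding U_Suc by (intro enn2real_leI V0)
  qed
  have U_eq: "ennreal (U (Suc n) t x) = \<Phi> (U n) t x" for n t x
  proof -
    have "\<Phi> (U n) t x \<le> ennreal (V t x)"
      by (rule order_trans[OF \<Phi>_mono \<Phi>V]) (use UV nonneg in auto)
    then show ?thesis unfolding U_Suc
      by (subst ennreal_enn2real) (auto intro: le_less_trans)
  qed
  have U_inc1: "U n t x \<le> U (Suc n) t x" for n t x
  proof (induction n arbitrary: t x)
    case 0 then show ?case by (simp add: U_0 nonneg)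
  next
    case (Suc n)
    have "\<Phi> (U n) t x \<le> \<Phi> (U (Suc n)) t x" by (rule \<Phi>_mono) (use Suc nonneg in auto)
    then show ?case using nonneg[of "Suc (Suc n)" t x] by (simp add: U_eq[symmetric])
  qed
  then have inc: "incseq (\<lambda>n. U n t x)" for t x by (intro incseq_SucI)
  define u where "u t x = lim (\<lambda>n. U n t x)" for t x
  have lim: "(\<lambda>n. U n t x) \<longlonglongrightarrow> u t x" for t x
    using incseq_convergent[OF inc, of t x "V t x"] UV unfolding u_def
    by (metis limI)
  have u0: "0 \<le> u t x" for t x by (rule LIMSEQ_le_const[OF lim]) (use nonneg in auto)
  have uV: "u t x \<le> V t x" for t x by (rule LIMSEQ_le_const2[OF lim]) (use UV in auto)
  have u_meas: "case_prod u \<in> borel_measurable (borel \<Otimes>\<^sub>M borel)"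
    by (rule borel_measurable_LIMSEQ_real[where u="\<lambda>n. case_prod (U n)"]) (auto intro: lim)
  have "ennreal (u t x) = \<Phi> u t x" for t x
  proof (rule LIMSEQ_unique)
    show "(\<lambda>n. ennreal (U (Suc n) t x)) \<longlonglongrightarrow> ennreal (u t x)"
      using lim LIMSEQ_Suc by (intro tendsto_ennrealI) blast
    have "(\<lambda>n. duhamel p (U n) t x) \<longlonglongrightarrow> (SUP n. duhamel p (U n) t x)"
      using inc nonneg k
      by (intro LIMSEQ_SUP incseq_SucI duhamel_mono U_inc1) auto
    also have "(SUP n. duhamel p (U n) t x) = duhamel p u t x"
      using k by (intro duhamel_SUP U_meas inc nonneg lim) auto
    finally show "(\<lambda>n. ennreal (U (Suc n) t x)) \<longlonglongrightarrow> \<Phi> u t x"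
      unfolding U_eq \<Phi>_def by (intro tendsto_add tendsto_const)
  qed
  then show ?thesis using u_meas u0 uV unfolding V_def \<Phi>_def by blast
qed

section \<open>Comparison of two solutions\<close>

text \<open>One step of the difference iteration. \<open>L\<close> is the Lipschitz constant of the
  nonlinearity on \<open>[0, M]\<close>, the kernel has mass 1, and integrating \<open>L\<close>
  times the error \<open>M * (L * s) ^ k / fact k\<close> from 0 to \<open>t\<close> produces the
  next term of the exponential series.\<close>

lemma duhamel_le_add:
  assumes [measurable]: "case_prod u \<in> borel_measurable (borel \<Otimes>\<^sub>M borel)"
      "case_prod v \<in> borel_measurable (borel \<Otimes>\<^sub>M borel)"
    and u: "\<And>s y. 0 \<le> u s y" "\<And>s y. u s y \<le> M" and v: "\<And>s y. 0 \<le> v s y"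
    and p: "1 \<le> p" and L: "L = p * M powr (p - 1)"
    and le: "AE s in lborel. 0 < s \<longrightarrow> (AE y in lborel. u s y \<le> v s y + M * (L * s) ^ k / fact k)"
    and t: "0 < t"
  shows "duhamel p u t x \<le> duhamel p v t x + ennreal (M * (L * t) ^ Suc k / fact (Suc k))"
proof -
  define c where "c s = M * (L * s) ^ k / fact k" for s :: real
  have M: "0 \<le> M" using u order_trans by blast
  have L0: "0 \<le> L" using p by (simp add: L)
  have c0: "0 \<le> c s" if "0 < s" for s using that M L0 unfolding c_def by simp
  have [measurable]: "c \<in> borel_measurable borel" unfolding c_def by measurable
  have "duhamel p u t x \<le> (\<integral>\<^sup>+s. (S (t - s) (\<lambda>y. ennreal (v s y powr p)) x * indicator {0<..} s
        + ennreal (L * c s) * indicator {0..t} s) \<partial>lborel)"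
    unfolding duhamel_def
  proof (intro nn_integral_mono_AE, use le in \<open>rule eventually_mono\<close>)
    fix s assume s: "0 < s \<longrightarrow> (AE y in lborel. u s y \<le> v s y + M * (L * s) ^ k / fact k)"
    show "S (t - s) (\<lambda>y. ennreal (u s y powr p)) x * indicator {0<..} s
      \<le> S (t - s) (\<lambda>y. ennreal (v s y powr p)) x * indicator {0<..} s + ennreal (L * c s) * indicator {0..t} s"
    proof (cases "0 < s \<and> s < t")
      case False
      then show ?thesis by (auto simp: indicator_def S_nonpos)
    next
      case True
      then have ae: "AE y in lborel. u s y \<le> v s y + c s" using s by (simp add: c_def)
      have "S (t - s) (\<lambda>y. ennreal (u s y powr p)) x
          \<le> S (t - s) (\<lambda>y. ennreal (v s y powr p) + ennreal (L * c s)) x"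
      proof (intro S_mono_AE, use ae in \<open>rule eventually_mono\<close>)
        fix y assume "u s y \<le> v s y + c s"
        then have "u s y powr p \<le> v s y powr p + L * c s"
          unfolding L using u v c0 True p by (intro powr_le_powr_add_linear) auto
        then show "ennreal (u s y powr p) \<le> ennreal (v s y powr p) + ennreal (L * c s)"
          using c0[of s] L0 True by (simp add: ennreal_plus[symmetric] ennreal_leI del: ennreal_plus)
      qed
      also have "\<dots> = S (t - s) (\<lambda>y. ennreal (v s y powr p)) x + ennreal (L * c s)"
        using True by (subst S_add) (auto simp: S_const)
      finally show ?thesis using True by simp
    qed
  qed
  also have "\<dots> = duhamel p v t x + (\<integral>\<^sup>+s. ennreal (L * c s) * indicator {0..t} s \<partial>lborel)"
    unfolding duhamel_def by (rule nn_integral_add) measurable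
  also have "(\<integral>\<^sup>+s. ennreal (L * c s) * indicator {0..t} s \<partial>lborel)
      = M * (L * t) ^ Suc k / fact (Suc k) - M * (L * 0) ^ Suc k / fact (Suc k)"
  proof (rule nn_integral_FTC_Icc)
    fix s :: real assume s: "s \<in> {0..t}"
    have e: "M * (real (Suc k) * (L * s) ^ k * L) / fact (Suc k) = L * c s"
      unfolding c_def fact_Suc by (simp add: divide_simps mult_ac)
    have "((\<lambda>s. M * (L * s) ^ Suc k / fact (Suc k)) has_real_derivative
        M * (real (Suc k) * (L * s) ^ k * L) / fact (Suc k)) (at s)"
    proof (intro DERIV_cdivide DERIV_cmult)
      have "((\<lambda>s. L * s) has_real_derivative L) (at s)"
        by (auto intro!: derivative_eq_intros)
      from DERIV_power_Suc[OF this, of k]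
      show "((\<lambda>s. (L * s) ^ Suc k) has_real_derivative real (Suc k) * (L * s) ^ k * L) (at s)"
        by (simp only: of_nat_Suc mult_ac)
    qed
    then show "((\<lambda>s. M * (L * s) ^ Suc k / fact (Suc k)) has_real_derivative L * c s) (at s)"
      unfolding e .
    show "0 \<le> L * c s" using s L0 M unfolding c_def by simp
  qed (use t in auto)
  finally show ?thesis by simp
qed

text \<open>\<open>U\<close> and \<open>V\<close> satisfy the equation at every time, while
  \<open>u\<close> and \<open>v\<close> are Borel representatives fit for integration. The estimate
  is derived for \<open>U\<close>, \<open>V\<close> at each \<open>t\<close>, passed to
  \<open>u\<close>, \<open>v\<close> for a.e. \<open>s\<close>, and fed back into the Duhamel
  integral. The linear term is an arbitrary common \<open>a\<close>, as it cancels. The induction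
  starts from \<open>u \<le> M \<le> v + M\<close>.\<close>

lemma mild_solution_le:
  assumes [measurable]: "case_prod u \<in> borel_measurable (borel \<Otimes>\<^sub>M borel)"
      "case_prod v \<in> borel_measurable (borel \<Otimes>\<^sub>M borel)"
    and u: "\<And>s y. 0 \<le> u s y" "\<And>s y. u s y \<le> M" and v: "\<And>s y. 0 \<le> v s y"
    and p: "1 \<le> p"
    and V0: "\<And>t x. 0 < t \<Longrightarrow> 0 \<le> V t x"
    and Uu: "AE s in lborel. 0 < s \<longrightarrow> (AE y in lborel. U s y = u s y)"
    and Vv: "AE s in lborel. 0 < s \<longrightarrow> (AE y in lborel. V s y = v s y)"
    and U: "\<And>t. 0 < t \<Longrightarrow> AE x in lborel. ennreal (U t x) = a t x + duhamel p u t x"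
    and V: "\<And>t. 0 < t \<Longrightarrow> AE x in lborel. ennreal (V t x) = a t x + duhamel p v t x"
    and t: "0 < t"
  shows "AE x in lborel. U t x \<le> V t x"
proof -
  define L where "L = p * M powr (p - 1)"
  have M: "0 \<le> M" using u order_trans by blast
  have L0: "0 \<le> L" using p by (simp add: L_def)
  have step: "AE x in lborel. U t x \<le> V t x + M * (L * t) ^ Suc k / fact (Suc k)"
    if le: "AE s in lborel. 0 < s \<longrightarrow> (AE y in lborel. u s y \<le> v s y + M * (L * s) ^ k / fact k)"
      and t: "0 < t" for k t
    using U[OF t] V[OF t]
  proof eventually_elim
    case (elim x)
    have c: "0 \<le> M * (L * t) ^ Suc k / fact (Suc k)" using M L0 t by simp
    have "ennreal (U t x) \<le> a t x + (duhamel p v t x + ennreal (M * (L * t) ^ Suc k / fact (Suc k)))"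
      unfolding elim(1) using u v p le t
      by (intro add_left_mono duhamel_le_add[where M=M and L=L]) (auto simp: L_def)
    also have "\<dots> = ennreal (V t x) + ennreal (M * (L * t) ^ Suc k / fact (Suc k))"
      unfolding elim(2) by (simp add: add.assoc)
    also have "\<dots> = ennreal (V t x + M * (L * t) ^ Suc k / fact (Suc k))"
      using V0[OF t] c by (subst ennreal_plus) auto
    finally show ?case
      using V0[OF t, of x] c by (subst (asm) ennreal_le_iff) auto
  qed
  have main: "AE s in lborel. 0 < s \<longrightarrow> (AE y in lborel. u s y \<le> v s y + M * (L * s) ^ k / fact k)" for k
  proof (induction k)
    case 0
    have "u s y \<le> v s y + M" for s y using u(2)[of s y] v[of s y] by linarith
    then show ?case by simp
  next
    case (Suc k)
    show ?case
      using Uu Vv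
    proof eventually_elim
      case (elim s)
      show ?case
      proof
        assume s: "0 < s"
        from elim s have "AE y in lborel. U s y = u s y" "AE y in lborel. V s y = v s y" by auto
        with step[OF Suc.IH s] show "AE y in lborel. u s y \<le> v s y + M * (L * s) ^ Suc k / fact (Suc k)"
          by eventually_elim simp
      qed
    qed
  qed
  \<comment> \<open>The exceptional null sets are countably many, so one null set serves all
    \<open>k\<close>; the error is a term of a convergent exponential series and tends to 0.\<close>
  have "AE x in lborel. \<forall>k. U t x \<le> V t x + M * (L * t) ^ Suc k / fact (Suc k)"
    unfolding AE_all_countable using step[OF main t] by blast
  then show ?thesis
  proof eventually_elim
    case (elim x)
    have "(\<lambda>k. inverse (fact k) * (L * t) ^ k) \<longlonglongrightarrow> 0"
      by (intro summable_LIMSEQ_zero summable_exp)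
    then have "(\<lambda>k. V t x + M * (inverse (fact (Suc k)) * (L * t) ^ Suc k)) \<longlonglongrightarrow> V t x + M * 0"
      by (intro tendsto_intros) (rule LIMSEQ_Suc)
    then have "U t x \<le> V t x + M * 0"
      by (rule LIMSEQ_le_const) (use elim in \<open>auto simp: field_simps\<close>)
    then show ?case by simp
  qed
qed

section \<open>Smoothing in weak and strong Lebesgue spaces\<close>

text \<open>Layer-cake formula: the integral of the positive part of \<open>f - l\<close> equals
  that of the distribution function over \<open>[l, \<infinity>)\<close>, where
  \<open>\<tau> powr (- m)\<close> is integrable because \<open>m > 1\<close>. The positive part
  needs no notation, since \<open>ennreal\<close> sends negative reals to 0.\<close>

lemma nn_integral_excess_le:
  assumes [measurable]: "f \<in> borel_measurable borel" and m: "1 < m" and l: "0 < l"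
    and distr: "\<And>\<tau>. 0 < \<tau> \<Longrightarrow> emeasure \<mu> {x. \<tau> < f x} \<le> ennreal ((A / \<tau>) powr m)"
  shows "(\<integral>\<^sup>+x. ennreal (f x - l) \<partial>\<mu>) \<le> ennreal (A powr m * l powr (1 - m) / (m - 1))"
proof -
  interpret P: pair_sigma_finite lborel \<mu> ..
  have "(\<integral>\<^sup>+x. ennreal (f x - l) \<partial>\<mu>) = (\<integral>\<^sup>+x. (\<integral>\<^sup>+\<tau>. (if l \<le> \<tau> \<and> \<tau> < f x then 1 else 0) \<partial>lborel) \<partial>\<mu>)"
  proof (intro nn_integral_cong)
    fix x
    have "(\<integral>\<^sup>+\<tau>. (if l \<le> \<tau> \<and> \<tau> < f x then 1 else 0) \<partial>lborel) = (\<integral>\<^sup>+\<tau>. indicator {l..<f x} \<tau> \<partial>lborel)"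
      by (intro nn_integral_cong) (auto simp: indicator_def)
    also have "\<dots> = ennreal (f x - l)"
      by (cases "l \<le> f x") (auto simp: ennreal_neg)
    finally show "ennreal (f x - l) = (\<integral>\<^sup>+\<tau>. (if l \<le> \<tau> \<and> \<tau> < f x then 1 else 0) \<partial>lborel)" ..
  qed
  also have "\<dots> = (\<integral>\<^sup>+\<tau>. (\<integral>\<^sup>+x. (if l \<le> \<tau> \<and> \<tau> < f x then 1 else 0) \<partial>\<mu>) \<partial>lborel)"
    by (rule P.Fubini') measurable
  also have "\<dots> \<le> (\<integral>\<^sup>+\<tau>. ennreal (A powr m * \<tau> powr (- m)) * indicator {l..} \<tau> \<partial>lborel)"
  proof (intro nn_integral_mono)
    fix \<tau> :: real
    show "(\<integral>\<^sup>+x. (if l \<le> \<tau> \<and> \<tau> < f x then 1 else 0) \<partial>\<mu>) \<le> ennreal (A powr m * \<tau> powr (- m)) * indicator {l..} \<tau>"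
    proof (cases "l \<le> \<tau>")
      case True
      have "(\<integral>\<^sup>+x. (if l \<le> \<tau> \<and> \<tau> < f x then 1 else 0) \<partial>\<mu>) = (\<integral>\<^sup>+x. indicator {x. \<tau> < f x} x \<partial>\<mu>)"
        using True by (intro nn_integral_cong) (auto simp: indicator_def)
      also have "\<dots> = emeasure \<mu> {x. \<tau> < f x}"
        by (rule nn_integral_indicator) (simp add: sets_mu)
      also have "\<dots> \<le> ennreal ((A / \<tau>) powr m)" using True l by (intro distr) auto
      also have "(A / \<tau>) powr m = A powr m * \<tau> powr (- m)"
        by (simp add: powr_divide powr_minus_divide)
      finally show ?thesis using True by simp
    qed simp
  qed
  also have "\<dots> = (\<integral>\<^sup>+\<tau>. ennreal (A powr m) * (ennreal (\<tau> powr (- m)) * indicator {l..} \<tau>) \<partial>lborel)"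
    by (simp add: ennreal_mult mult.assoc)
  also have "\<dots> = ennreal (A powr m) * ennreal (l powr (1 - m) / (m - 1))"
    by (subst nn_integral_cmult) (auto simp: nn_integral_powr_atLeast[OF m l])
  also have "\<dots> = ennreal (A powr m * l powr (1 - m) / (m - 1))"
    using m by (simp add: ennreal_mult[symmetric])
  finally show ?thesis .
qed

lemma S_le_excess:
  assumes [measurable]: "f \<in> borel_measurable borel" and "0 < t" "0 \<le> l"
  shows "S t (\<lambda>y. ennreal (f y)) x \<le> ennreal l + S t (\<lambda>y. ennreal (f y - l)) x"
proof -
  have "ennreal (f y) \<le> ennreal l + ennreal (f y - l)" for y
    using assms(3) by (cases "l \<le> f y") (auto simp: ennreal_plus[symmetric] ennreal_neg intro: ennreal_leI simp del: ennreal_plus)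
  then have "S t (\<lambda>y. ennreal (f y)) x \<le> S t (\<lambda>y. ennreal l + ennreal (f y - l)) x"
    by (rule S_mono)
  then show ?thesis using assms by (subst (asm) S_add) (auto simp: S_const)
qed

text \<open>Below the height \<open>l\<close> the mass-1 kernel preserves the bound
  \<open>l\<close>; the excess above \<open>l\<close> is integrable and is handled by the sup bound
  of the kernel.\<close>

lemma S_weak_smoothing:
  assumes [measurable]: "f \<in> borel_measurable borel" and m: "1 < m" and A: "0 < A" and t: "0 < t"
    and distr: "\<And>\<tau>. 0 < \<tau> \<Longrightarrow> emeasure \<mu> {x. \<tau> < f x} \<le> ennreal ((A / \<tau>) powr m)"
  shows "S t (\<lambda>y. ennreal (f y)) x \<le> ennreal ((1 + C / (m - 1)) * A * t powr (- (N / (2 * m))))"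
proof -
  \<comment> \<open>The height at which both contributions have the same order: the excess then
    contributes exactly \<open>C / (m - 1) * l\<close>.\<close>
  define l where "l = A * t powr (- (N / (2 * m)))"
  have l: "0 < l" using A t by (simp add: l_def)
  have "C * t powr (- (N / 2)) * (A powr m * l powr (1 - m) / (m - 1)) = C / (m - 1) * l"
  proof -
    have "t powr (- (N / 2)) * (A powr m * l powr (1 - m))
        = (A powr m * A powr (1 - m)) * (t powr (- (N / 2)) * t powr (- (N / (2 * m)) * (1 - m)))"
      unfolding l_def powr_mult powr_powr by (simp add: mult_ac)
    also have "A powr m * A powr (1 - m) = A" using A by (simp add: powr_add[symmetric])
    also have "t powr (- (N / 2)) * t powr (- (N / (2 * m)) * (1 - m)) = t powr (- (N / 2) + - (N / (2 * m)) * (1 - m))"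
      unfolding powr_add ..
    also have "- (N / 2) + - (N / (2 * m)) * (1 - m) = - (N / (2 * m))"
      using m by (simp add: field_simps)
    finally show ?thesis by (simp add: l_def mult_ac)
  qed
  note e = this
  have "S t (\<lambda>y. ennreal (f y)) x \<le> ennreal l + S t (\<lambda>y. ennreal (f y - l)) x"
    using l t by (intro S_le_excess) auto
  also have "S t (\<lambda>y. ennreal (f y - l)) x \<le> ennreal (C * t powr (- (N / 2))) * (\<integral>\<^sup>+y. ennreal (f y - l) \<partial>\<mu>)"
    using t by (intro S_le_nn_integral) auto
  also have "\<dots> \<le> ennreal (C * t powr (- (N / 2))) * ennreal (A powr m * l powr (1 - m) / (m - 1))"
    using m l by (intro mult_left_mono nn_integral_excess_le distr) auto
  also have "\<dots> = ennreal (C * t powr (- (N / 2)) * (A powr m * l powr (1 - m) / (m - 1)))"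
    using C_pos m by (subst ennreal_mult) auto
  also note e
  also have "ennreal l + ennreal (C / (m - 1) * l) = ennreal (l + C / (m - 1) * l)"
    using C_pos m l by (subst ennreal_plus) auto
  finally show ?thesis by (simp add: l_def algebra_simps)
qed

text \<open>The part of \<open>f\<close> below \<open>\<tau> / 2\<close> evolves to at most
  \<open>\<tau> / 2\<close>, so the excess must exceed \<open>\<tau> / 2\<close> wherever the whole
  exceeds \<open>\<tau>\<close>. Markov's inequality and conservation of the integral then reduce
  the claim to \<open>nn_integral_excess_le\<close>.\<close>

lemma S_weak_distr:
  assumes [measurable]: "f \<in> borel_measurable borel" and m: "1 < m" and t: "0 < t" and \<tau>: "0 < \<tau>"
    and distr: "\<And>\<tau>. 0 < \<tau> \<Longrightarrow> emeasure \<mu> {x. \<tau> < f x} \<le> ennreal ((A / \<tau>) powr m)"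
  shows "emeasure \<mu> {x. ennreal \<tau> < S t (\<lambda>y. ennreal (f y)) x} \<le> ennreal ((2 * A / \<tau>) powr m / (m - 1))"
proof -
  have "emeasure \<mu> {x. ennreal \<tau> < S t (\<lambda>y. ennreal (f y)) x}
      \<le> emeasure \<mu> {x\<in>UNIV. 1 \<le> ennreal (2 / \<tau>) * S t (\<lambda>y. ennreal (f y - \<tau> / 2)) x}"
  proof (intro emeasure_mono subsetI)
    fix x assume "x \<in> {x. ennreal \<tau> < S t (\<lambda>y. ennreal (f y)) x}"
    then have "ennreal (\<tau> / 2) + ennreal (\<tau> / 2) < ennreal (\<tau> / 2) + S t (\<lambda>y. ennreal (f y - \<tau> / 2)) x"
      using S_le_excess[OF assms(1) t, of "\<tau> / 2" x] \<tau>
      by (subst ennreal_plus[symmetric]) (auto intro: less_le_trans)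
    then have "ennreal (\<tau> / 2) \<le> S t (\<lambda>y. ennreal (f y - \<tau> / 2)) x"
      by (simp add: ennreal_add_left_cancel_less)
    then have "ennreal (2 / \<tau>) * ennreal (\<tau> / 2) \<le> ennreal (2 / \<tau>) * S t (\<lambda>y. ennreal (f y - \<tau> / 2)) x"
      by (rule mult_left_mono) simp
    moreover have "ennreal (2 / \<tau>) * ennreal (\<tau> / 2) = 1" using \<tau> by (simp add: ennreal_mult[symmetric])
    ultimately show "x \<in> {x\<in>UNIV. 1 \<le> ennreal (2 / \<tau>) * S t (\<lambda>y. ennreal (f y - \<tau> / 2)) x}" by simp
  next
    have [measurable]: "(\<lambda>x. S t (\<lambda>y. ennreal (f y - \<tau> / 2)) x) \<in> borel_measurable borel" by measurable
    show "{x\<in>UNIV. 1 \<le> ennreal (2 / \<tau>) * S t (\<lambda>y. ennreal (f y - \<tau> / 2)) x} \<in> sets \<mu>"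
      unfolding sets_mu by measurable
  qed
  also have "\<dots> \<le> ennreal (2 / \<tau>) * (\<integral>\<^sup>+x. S t (\<lambda>y. ennreal (f y - \<tau> / 2)) x * indicator UNIV x \<partial>\<mu>)"
    by (rule nn_integral_Markov_inequality) (auto simp: sets_mu)
  also have "\<dots> = ennreal (2 / \<tau>) * (\<integral>\<^sup>+x. ennreal (f x - \<tau> / 2) \<partial>\<mu>)"
    using t by (simp add: nn_integral_S)
  also have "\<dots> \<le> ennreal (2 / \<tau>) * ennreal (A powr m * (\<tau> / 2) powr (1 - m) / (m - 1))"
    using \<tau> by (intro mult_left_mono nn_integral_excess_le distr m) auto
  also have "\<dots> = ennreal (2 / \<tau> * (A powr m * (\<tau> / 2) powr (1 - m) / (m - 1)))"
    using \<tau> m by (subst ennreal_mult) auto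
  also have "2 / \<tau> * (A powr m * (\<tau> / 2) powr (1 - m) / (m - 1)) = (2 * A / \<tau>) powr m / (m - 1)"
  proof -
    have "2 * A / \<tau> = A / (\<tau> / 2)" by simp
    then have "(2 * A / \<tau>) powr m = A powr m / (\<tau> / 2) powr m" by (simp only: powr_divide)
    moreover have "(\<tau> / 2) powr (1 - m) = \<tau> / 2 / (\<tau> / 2) powr m" using \<tau> by (simp add: powr_diff)
    ultimately show ?thesis using \<tau> by simp
  qed
  finally show ?thesis .
qed

text \<open>Jensen's inequality with exponent \<open>m\<close>, followed by the passage from
  integral to sup norm for \<open>f powr m\<close>.\<close>

lemma S_strong_smoothing:
  assumes [measurable]: "f \<in> borel_measurable borel" and f: "\<And>x. 0 \<le> f x" and m: "1 \<le> m" and t: "0 < t"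
    and J: "(\<integral>\<^sup>+x. ennreal (f x powr m) \<partial>\<mu>) \<le> ennreal J" "0 \<le> J"
  shows "S t (\<lambda>y. ennreal (f y)) x \<le> ennreal ((C * t powr (- (N / 2)) * J) powr (1 / m))"
proof -
  have "S t (\<lambda>y. ennreal (f y powr m)) x \<le> ennreal (C * t powr (- (N / 2))) * (\<integral>\<^sup>+x. ennreal (f x powr m) \<partial>\<mu>)"
    using t by (intro S_le_nn_integral) auto
  also have "\<dots> \<le> ennreal (C * t powr (- (N / 2))) * ennreal J"
    by (intro mult_left_mono J) auto
  also have "\<dots> = ennreal (C * t powr (- (N / 2)) * J)"
    using C_pos J by (subst ennreal_mult) auto
  finally have *: "S t (\<lambda>y. ennreal (f y powr m)) x \<le> ennreal (C * t powr (- (N / 2)) * J)" .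
  then have "S t (\<lambda>y. ennreal (f y)) x \<le> ennreal (enn2real (S t (\<lambda>y. ennreal (f y powr m)) x) powr (1 / m))"
    using f m t by (intro S_jensen) (auto intro: le_less_trans)
  also have "\<dots> \<le> ennreal ((C * t powr (- (N / 2)) * J) powr (1 / m))"
    using * C_pos J m by (intro ennreal_leI powr_mono2 enn2real_leI) auto
  finally show ?thesis .
qed

lemma profile_le_powr:
  assumes "S t (\<lambda>y. ennreal (f y powr k)) x \<le> ennreal g" "0 \<le> g" "0 < k"
  shows "profile k f t x \<le> g powr (1 / k)"
  unfolding profile_def using assms by (intro powr_mono2 enn2real_leI) auto

text \<open>Allows the weak estimates, which require an exponent above 1, to be applied to
  \<open>f powr k\<close> with exponent \<open>r / k\<close> and constant
  \<open>A powr k\<close>.\<close>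

lemma powr_distr:
  assumes "\<And>x. 0 \<le> f x" "0 < k" "0 < A" "0 < \<tau>"
    and distr: "\<And>\<tau>. 0 < \<tau> \<Longrightarrow> emeasure \<mu> {x. \<tau> < f x} \<le> ennreal ((A / \<tau>) powr r)"
  shows "emeasure \<mu> {x. \<tau> < f x powr k} \<le> ennreal ((A powr k / \<tau>) powr (r / k))"
proof -
  have "\<tau> < f x powr k \<longleftrightarrow> \<tau> powr (1 / k) < f x" for x
  proof
    assume "\<tau> < f x powr k"
    then have "\<tau> powr (1 / k) < (f x powr k) powr (1 / k)" using assms by (intro powr_less_mono2) auto
    then show "\<tau> powr (1 / k) < f x" using assms by (simp add: powr_powr)
  next
    assume "\<tau> powr (1 / k) < f x"
    then have "(\<tau> powr (1 / k)) powr k < f x powr k" using assms by (intro powr_less_mono2) auto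
    then show "\<tau> < f x powr k" using assms by (simp add: powr_powr)
  qed
  moreover have "(A / \<tau> powr (1 / k)) powr r = (A powr k / \<tau>) powr (r / k)"
    using assms by (simp add: powr_divide powr_powr)
  ultimately show ?thesis using distr[of "\<tau> powr (1 / k)"] assms by simp
qed

text \<open>Twice the profile exceeds \<open>\<tau>\<close> only where the semigroup on
  \<open>f powr k\<close> exceeds \<open>(\<tau> / 2) powr k\<close>; there
  \<open>S_weak_distr\<close> applies with exponent \<open>r / k\<close>, which exceeds 1 since
  \<open>k < r\<close>. \<open>E\<close> is uniform in time.\<close>

lemma profile_weak_distr:
  assumes [measurable]: "f \<in> borel_measurable borel" and f: "\<And>x. 0 \<le> f x" "\<And>x. f x \<le> B"
    and k: "1 \<le> k" "k < r" and A: "0 < A"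
    and distr: "\<And>\<tau>. 0 < \<tau> \<Longrightarrow> emeasure \<mu> {x. \<tau> < f x} \<le> ennreal ((A / \<tau>) powr r)"
  shows "\<exists>E>0. \<forall>t>0. \<forall>\<tau>>0. emeasure \<mu> {x. \<tau> < 2 * profile k f t x} \<le> ennreal ((E / \<tau>) powr r)"
proof (intro exI conjI allI impI)
  \<comment> \<open>The factor \<open>2 powr (r / k)\<close> stems from cutting at half the height
    in \<open>S_weak_distr\<close>, the factor 2 before \<open>A\<close> from doubling the profile;
    the outer root \<open>1 / r\<close> absorbs the constants into
    \<open>(E / \<tau>) powr r\<close>.\<close>
  define E where "E = (2 powr (r / k) / (r / k - 1)) powr (1 / r) * (2 * A)"
  have m: "1 < r / k" using k by simp
  show "0 < E" using m A k unfolding E_def by (intro mult_pos_pos) auto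
  fix t \<tau> :: real assume t: "0 < t" and \<tau>: "0 < \<tau>"
  have "emeasure \<mu> {x. \<tau> < 2 * profile k f t x} \<le> emeasure \<mu> {x. ennreal ((\<tau> / 2) powr k) < S t (\<lambda>y. ennreal (f y powr k)) x}"
  proof (intro emeasure_mono subsetI CollectI)
    fix x assume "x \<in> {x. \<tau> < 2 * profile k f t x}"
    then have "(\<tau> / 2) powr k < profile k f t x powr k" using \<tau> k by (intro powr_less_mono2) auto
    then have *: "(\<tau> / 2) powr k < enn2real (S t (\<lambda>y. ennreal (f y powr k)) x)"
      using k unfolding profile_def by (simp add: powr_powr)
    have "S t (\<lambda>y. ennreal (f y powr k)) x < \<infinity>"
      using S_powr_le[of f B k t x] f k t by (auto intro: le_less_trans)
    then have "S t (\<lambda>y. ennreal (f y powr k)) x = ennreal (enn2real (S t (\<lambda>y. ennreal (f y powr k)) x))"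
      by (simp add: ennreal_enn2real)
    then show "ennreal ((\<tau> / 2) powr k) < S t (\<lambda>y. ennreal (f y powr k)) x"
      using * by (metis ennreal_lessI enn2real_nonneg order_le_less_trans powr_ge_zero)
  next
    have [measurable]: "(\<lambda>x. S t (\<lambda>y. ennreal (f y powr k)) x) \<in> borel_measurable borel" by measurable
    show "{x. ennreal ((\<tau> / 2) powr k) < S t (\<lambda>y. ennreal (f y powr k)) x} \<in> sets \<mu>"
      unfolding sets_mu by measurable
  qed
  also have "\<dots> \<le> ennreal ((2 * A powr k / (\<tau> / 2) powr k) powr (r / k) / (r / k - 1))"
    using m t \<tau> k A f by (intro S_weak_distr powr_distr distr) auto
  also have "(2 * A powr k / (\<tau> / 2) powr k) powr (r / k) / (r / k - 1) = (E / \<tau>) powr r"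
  proof -
    have "(2 * A powr k / (\<tau> / 2) powr k) powr (r / k) = 2 powr (r / k) * (A / (\<tau> / 2)) powr r"
    proof -
      have "2 * A powr k / (\<tau> / 2) powr k = 2 * (A / (\<tau> / 2)) powr k"
        by (simp only: powr_divide times_divide_eq_right)
      then show ?thesis using k by (simp only: powr_mult powr_powr) simp
    qed
    moreover have "(E / \<tau>) powr r = (2 powr (r / k) / (r / k - 1)) powr (1 / r * r) * (A / (\<tau> / 2)) powr r"
      unfolding E_def powr_powr[symmetric] powr_mult[symmetric] by (simp add: mult_ac)
    ultimately show ?thesis using k m by simp
  qed
  finally show "emeasure \<mu> {x. \<tau> < 2 * profile k f t x} \<le> ennreal ((E / \<tau>) powr r)" .
qed

text \<open>Jensen's inequality with exponent \<open>r / k\<close> bounds the profile to the power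
  \<open>r\<close> by the semigroup on \<open>f powr r\<close>, whose integral is conserved.\<close>

lemma profile_strong:
  assumes [measurable]: "f \<in> borel_measurable borel" and f: "\<And>x. 0 \<le> f x" "\<And>x. f x \<le> B"
    and k: "1 \<le> k" "k \<le> r" and A: "0 \<le> A" and t: "0 < t"
    and J: "(\<integral>\<^sup>+x. ennreal (f x powr r) \<partial>\<mu>) \<le> ennreal (A powr r)"
  shows "(\<integral>\<^sup>+x. ennreal ((2 * profile k f t x) powr r) \<partial>\<mu>) \<le> ennreal ((2 * A) powr r)"
proof -
  have "ennreal (profile k f t x powr r) \<le> S t (\<lambda>y. ennreal (f y powr r)) x" for x
  proof -
    have fin: "S t (\<lambda>y. ennreal (f y powr j)) x < \<infinity>" if "0 \<le> j" for j
      using S_powr_le[of f B j t x] f that t by (auto intro: le_less_trans)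
    define m where "m = r / k"
    have m: "1 \<le> m" "k * m = r" using k unfolding m_def by auto
    have "S t (\<lambda>y. ennreal (f y powr k)) x
        \<le> ennreal (enn2real (S t (\<lambda>y. ennreal ((f y powr k) powr m)) x) powr (1 / m))"
      using fin[of r] m t k by (intro S_jensen) (auto simp: powr_powr)
    then have "enn2real (S t (\<lambda>y. ennreal (f y powr k)) x) \<le> enn2real (S t (\<lambda>y. ennreal (f y powr r)) x) powr (1 / m)"
      using m by (intro enn2real_leI) (auto simp: powr_powr)
    then have pm: "enn2real (S t (\<lambda>y. ennreal (f y powr k)) x) powr m \<le> (enn2real (S t (\<lambda>y. ennreal (f y powr r)) x) powr (1 / m)) powr m"
      using m by (intro powr_mono2) auto
    have "profile k f t x powr r \<le> enn2real (S t (\<lambda>y. ennreal (f y powr r)) x)"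
    proof -
      have "1 / m * m = 1" "1 / k * r = m" using m by (auto simp: m_def)
      with pm show ?thesis unfolding profile_def powr_powr by simp
    qed
    then have "ennreal (profile k f t x powr r) \<le> ennreal (enn2real (S t (\<lambda>y. ennreal (f y powr r)) x))"
      by (rule ennreal_leI)
    also have "\<dots> = S t (\<lambda>y. ennreal (f y powr r)) x"
      using fin[of r] k by (intro ennreal_enn2real) auto
    finally show ?thesis .
  qed
  then have "ennreal ((2 * profile k f t x) powr r) \<le> ennreal (2 powr r) * S t (\<lambda>y. ennreal (f y powr r)) x" for x
    by (simp add: powr_mult ennreal_mult mult_left_mono)
  then have "(\<integral>\<^sup>+x. ennreal ((2 * profile k f t x) powr r) \<partial>\<mu>)
      \<le> (\<integral>\<^sup>+x. ennreal (2 powr r) * S t (\<lambda>y. ennreal (f y powr r)) x \<partial>\<mu>)"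
    by (rule nn_integral_mono)
  also have "\<dots> = ennreal (2 powr r) * (\<integral>\<^sup>+x. ennreal (f x powr r) \<partial>\<mu>)"
    using t by (simp add: nn_integral_cmult nn_integral_S)
  also have "\<dots> \<le> ennreal (2 powr r) * ennreal (A powr r)"
    by (intro mult_left_mono J) auto
  finally show ?thesis by (simp add: powr_mult ennreal_mult)
qed

section \<open>Mild solutions for small data\<close>

text \<open>Common interface of the critical and subcritical constructions. The domination by the
  profile is kept because integrability bounds and the sup bound are read off from it later.\<close>

definition decaying_mild_solution :: "real \<Rightarrow> real \<Rightarrow> real \<Rightarrow> ('a \<Rightarrow> real) \<Rightarrow> bool" where
  "decaying_mild_solution p k r f \<longleftrightarrow>
    (\<exists>u c. case_prod u \<in> borel_measurable (borel \<Otimes>\<^sub>M borel) \<and> (\<forall>t x. 0 \<le> u t x) \<and>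
        (\<forall>t x. u t x \<le> 2 * profile k f t x) \<and>
        (\<forall>t x. ennreal (u t x) = S t (\<lambda>y. ennreal (f y)) x + duhamel p u t x) \<and>
        (\<forall>t>0. \<forall>x. 2 * profile k f t x \<le> c * t powr (- (N / (2 * r)))))"

text \<open>Since \<open>N / (2 * rs) = 1 / (p - 1)\<close>, the bound \<open>G\<close> is a
  multiple of \<open>t powr (- (k / (p - 1)))\<close>. The integral of its power
  \<open>p / k - 1\<close> grows like \<open>t powr e\<close>, while the prefactor decays like
  \<open>t powr (- e)\<close>: scale invariance in the critical space.\<close>

lemma small_weak_solution:
  assumes p: "1 < p" and rs: "rs = N / 2 * (p - 1)" "1 < rs"
  shows "\<exists>\<delta>>0. \<exists>k. 1 < k \<and> k < rs \<and> (\<forall>f B. f \<in> borel_measurable borel \<longrightarrow>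
      (\<forall>x. 0 \<le> f x) \<longrightarrow> (\<forall>x. f x \<le> B) \<longrightarrow>
      (\<forall>\<tau>>0. emeasure \<mu> {x. \<tau> < f x} \<le> ennreal ((\<delta> / \<tau>) powr rs)) \<longrightarrow>
      decaying_mild_solution p k rs f)"
proof -
  \<comment> \<open>The midpoint of the admissible interval between 1 and
    \<open>min p rs\<close>.\<close>
  define k where "k = (1 + min p rs) / 2"
  have k: "1 < k" "k < p" "k < rs" using p rs(2) unfolding k_def by (auto simp: min_def)
  define m where "m = rs / k"
  have m: "1 < m" using k unfolding m_def by simp
  define b where "b = 1 + C / (m - 1)"
  have b: "0 < b" using C_pos m unfolding b_def by (intro add_pos_pos) auto
  define e where "e = (k - 1) / (p - 1)"
  have e: "0 < e" using k p unfolding e_def by simp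
  \<comment> \<open>Solves the smallness condition with equality: for
    \<open>c1 = b * \<delta> powr k\<close> it reads
    \<open>c1 powr ((p - 1) / k) / e = 2 powr (- p)\<close>.\<close>
  define \<delta> where "\<delta> = (2 powr (- p) * e / b powr ((p - 1) / k)) powr (1 / (p - 1))"
  have \<delta>: "0 < \<delta>" unfolding \<delta>_def using e b by simp
  define c where "c = 2 * (b * \<delta> powr k) powr (1 / k)"
  define G where "G t = b * \<delta> powr k * t powr (- (k / (p - 1)))" for t
  have Nm: "N / (2 * m) = k / (p - 1)" "N / (2 * rs) = 1 / (p - 1)"
  proof -
    show e: "N / (2 * rs) = 1 / (p - 1)" unfolding rs(1) using N_pos p by simp
    have "N / (2 * m) = k * (N / (2 * rs))" unfolding m_def by simp
    then show "N / (2 * m) = k / (p - 1)" unfolding e by simp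
  qed
  have G0: "0 \<le> G t" for t using b unfolding G_def by simp
  have small: "ennreal (G t powr (1 - 1 / k)) * (\<integral>\<^sup>+s\<in>{0<..<t}. ennreal (G s powr (p / k - 1)) \<partial>lborel)
        \<le> ennreal (2 powr (- p))" if t: "0 < t" for t
  proof -
    define c1 where "c1 = b * \<delta> powr k"
    have c1: "0 < c1" using b \<delta> unfolding c1_def by simp
    have ex: "- (k / (p - 1)) * (p / k - 1) = e - 1" "- (k / (p - 1)) * (1 - 1 / k) = - e"
      using k p unfolding e_def by (simp_all add: divide_simps)
    have "(\<integral>\<^sup>+s\<in>{0<..<t}. ennreal (G s powr (p / k - 1)) \<partial>lborel)
        = (\<integral>\<^sup>+s. ennreal (c1 powr (p / k - 1)) * (ennreal (s powr (e - 1)) * indicator {0<..<t} s) \<partial>lborel)"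
      unfolding G_def c1_def[symmetric] powr_mult powr_powr ex
      by (simp add: ennreal_mult mult_ac)
    also have "\<dots> = ennreal (c1 powr (p / k - 1)) * ennreal (t powr e / e)"
      by (subst nn_integral_cmult) (auto simp: nn_integral_powr_from_0[OF e t])
    finally have I: "(\<integral>\<^sup>+s\<in>{0<..<t}. ennreal (G s powr (p / k - 1)) \<partial>lborel)
        = ennreal (c1 powr (p / k - 1)) * ennreal (t powr e / e)" .
    have "ennreal (G t powr (1 - 1 / k)) * (\<integral>\<^sup>+s\<in>{0<..<t}. ennreal (G s powr (p / k - 1)) \<partial>lborel)
        = ennreal (c1 powr (1 - 1 / k) * t powr (- e) * (c1 powr (p / k - 1) * (t powr e / e)))"
    proof -
      have mult4: "ennreal x * ennreal y * (ennreal z * ennreal z') = ennreal (x * y * (z * z'))"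
        if "0 \<le> x" "0 \<le> y" "0 \<le> z" "0 \<le> z'" for x y z z'
        using that by (simp add: ennreal_mult)
      have "ennreal (G t powr (1 - 1 / k)) = ennreal (c1 powr (1 - 1 / k)) * ennreal (t powr (- e))"
        unfolding G_def c1_def[symmetric] powr_mult powr_powr ex by (simp add: ennreal_mult)
      then show ?thesis unfolding I using e by (simp only:) (intro mult4, auto)
    qed
    also have "c1 powr (1 - 1 / k) * t powr (- e) * (c1 powr (p / k - 1) * (t powr e / e))
        = (c1 powr (1 - 1 / k) * c1 powr (p / k - 1)) * (t powr (- e) * t powr e) / e"
      by simp
    also have "c1 powr (1 - 1 / k) * c1 powr (p / k - 1) = c1 powr ((p - 1) / k)"
      unfolding powr_add[symmetric] using k by (simp add: diff_divide_distrib)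
    also have "t powr (- e) * t powr e = 1" using t by (simp add: powr_add[symmetric])
    also have "c1 powr ((p - 1) / k) = b powr ((p - 1) / k) * \<delta> powr (p - 1)"
      unfolding c1_def powr_mult powr_powr using k by simp
    also have "\<delta> powr (p - 1) = 2 powr (- p) * e / b powr ((p - 1) / k)"
      unfolding \<delta>_def powr_powr using p e b by simp
    also have "b powr ((p - 1) / k) * (2 powr (- p) * e / b powr ((p - 1) / k)) * 1 / e = 2 powr (- p)"
      using b e by simp
    finally show ?thesis by simp
  qed
  show ?thesis
  proof (rule exI[of _ \<delta>], rule conjI[OF \<delta>], rule exI[of _ k], intro conjI allI impI)
    show "1 < k" "k < rs" using k by auto
    fix f :: "'a \<Rightarrow> real" and B
    assume f [measurable]: "f \<in> borel_measurable borel" and "\<forall>x. 0 \<le> f x" "\<forall>x. f x \<le> B"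
      and "\<forall>\<tau>>0. emeasure \<mu> {x. \<tau> < f x} \<le> ennreal ((\<delta> / \<tau>) powr rs)"
    then have f0: "\<And>x. 0 \<le> f x" "\<And>x. f x \<le> B"
      and distr: "\<And>\<tau>. 0 < \<tau> \<Longrightarrow> emeasure \<mu> {x. \<tau> < f x} \<le> ennreal ((\<delta> / \<tau>) powr rs)" by auto
    have G: "S t (\<lambda>y. ennreal (f y powr k)) x \<le> ennreal (G t)" if "0 < t" for t x
      unfolding G_def Nm(1)[symmetric] b_def
      using m \<delta> that k f0 by (intro S_weak_smoothing) (auto simp: m_def intro!: powr_distr distr)
    have [measurable]: "G \<in> borel_measurable borel" unfolding G_def by measurable
    have "\<exists>u. case_prod u \<in> borel_measurable (borel \<Otimes>\<^sub>M borel) \<and> (\<forall>t x. 0 \<le> u t x) \<and>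
        (\<forall>t x. u t x \<le> 2 * profile k f t x) \<and>
        (\<forall>t x. ennreal (u t x) = S t (\<lambda>y. ennreal (f y)) x + duhamel p u t x)"
      using k G G0 small f0 by (intro mild_solution_exists[where G=G and B=B]) auto
    moreover have "2 * profile k f t x \<le> c * t powr (- (N / (2 * rs)))" if "0 < t" for t x
    proof -
      have "profile k f t x \<le> G t powr (1 / k)"
        using G[OF that] G0 k by (intro profile_le_powr) auto
      also have "\<dots> = (b * \<delta> powr k) powr (1 / k) * t powr (- (k / (p - 1)) * (1 / k))"
        unfolding G_def by (simp only: powr_mult powr_powr)
      also have "- (k / (p - 1)) * (1 / k) = - (N / (2 * rs))"
        unfolding Nm using k by simp
      finally show ?thesis unfolding c_def by simp
    qed
    ultimately show "decaying_mild_solution p k rs f" unfolding decaying_mild_solution_def by blast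
  qed
qed

text \<open>With \<open>k = 1\<close> the condition only asks that the integral of
  \<open>G powr (p - 1)\<close> be small. The sup bound controls it near 0; the decay bound controls
  it at infinity because \<open>s powr (- \<gamma>)\<close> has
  \<open>\<gamma> = rs / r > 1\<close>, which is where \<open>r < rs\<close> enters.\<close>

lemma small_strong_solution:
  assumes p: "1 < p" and rs: "rs = N / 2 * (p - 1)" and r: "1 \<le> r" "r < rs"
  shows "\<exists>\<delta>>0. \<forall>f A B. f \<in> borel_measurable borel \<longrightarrow> (\<forall>x. 0 \<le> f x) \<longrightarrow> (\<forall>x. f x \<le> B) \<longrightarrow> 0 \<le> A \<longrightarrow>
      (\<integral>\<^sup>+x. ennreal (f x powr r) \<partial>\<mu>) \<le> ennreal (A powr r) \<longrightarrow>
      A powr (r / rs) * B powr (1 - r / rs) < \<delta> \<longrightarrow> decaying_mild_solution p 1 r f"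
proof -
  define \<gamma> where "\<gamma> = rs / r"
  have \<gamma>: "1 < \<gamma>" using r unfolding \<gamma>_def by simp
  have \<gamma>_eq: "N / (2 * r) * (p - 1) = \<gamma>" unfolding \<gamma>_def rs by simp
  \<comment> \<open>The 1 accounts for times up to the crossover time \<open>T\<close>, the fraction
    for the tail beyond it; \<open>C powr (1 / r)\<close> comes from the smoothing estimate. The
    next constant makes \<open>b * \<delta> powr (p - 1) = 2 powr (- p)\<close>.\<close>
  define b where "b = 1 + C powr ((p - 1) / r) / (\<gamma> - 1)"
  have b: "0 < b" using \<gamma> unfolding b_def by (intro add_pos_nonneg) auto
  define \<delta> where "\<delta> = (2 powr (- p) / b) powr (1 / (p - 1))"
  have \<delta>: "0 < \<delta>" using b unfolding \<delta>_def by simp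
  show ?thesis
  proof (intro exI[of _ \<delta>] conjI allI impI \<delta>)
    fix f :: "'a \<Rightarrow> real" and A B
    assume f [measurable]: "f \<in> borel_measurable borel" and f01: "\<forall>x. 0 \<le> f x" "\<forall>x. f x \<le> B"
      and A: "0 \<le> A" and J: "(\<integral>\<^sup>+x. ennreal (f x powr r) \<partial>\<mu>) \<le> ennreal (A powr r)"
      and sm: "A powr (r / rs) * B powr (1 - r / rs) < \<delta>"
    from f01 have f0: "\<And>x. 0 \<le> f x" "\<And>x. f x \<le> B" by auto
    then have B: "0 \<le> B" using order_trans by blast
    define c where "c = C powr (1 / r) * A"
    define G where "G t = min B (c * t powr (- (N / (2 * r))))" for t
    have c: "0 \<le> c" using A unfolding c_def by simp
    have G0: "0 \<le> G t" for t using B c unfolding G_def by simp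
    have [measurable]: "G \<in> borel_measurable borel" unfolding G_def by measurable
    have G2: "S t (\<lambda>y. ennreal (f y)) x \<le> ennreal (c * t powr (- (N / (2 * r))))" if t: "0 < t" for t x
    proof -
      have "S t (\<lambda>y. ennreal (f y)) x \<le> ennreal ((C * t powr (- (N / 2)) * A powr r) powr (1 / r))"
        using f0 r t J by (intro S_strong_smoothing) auto
      also have "(C * t powr (- (N / 2)) * A powr r) powr (1 / r) = c * t powr (- (N / (2 * r)))"
        unfolding c_def powr_mult powr_powr using A r by (simp add: mult_ac)
      finally show ?thesis .
    qed
    have G: "S t (\<lambda>y. ennreal (f y powr 1)) x \<le> ennreal (G t)" if "0 < t" for t x
    proof -
      have "S t (\<lambda>y. ennreal (f y)) x \<le> ennreal B"
        using that f0 by (intro S_le_const ennreal_leI) auto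
      then show ?thesis using G2[OF that, of x] f0 unfolding G_def by (simp add: min_def)
    qed
    have int: "(\<integral>\<^sup>+s\<in>{0<..<t}. ennreal (G s powr (p - 1)) \<partial>lborel) \<le> ennreal (2 powr (- p))" for t
    proof (cases "A = 0 \<or> B = 0")
      \<comment> \<open>The crossover time below is meaningful only for positive \<open>A\<close>
        and \<open>B\<close>; otherwise \<open>G\<close> vanishes.\<close>
      case True
      then have "G s = 0" if "0 < s" for s using that B c unfolding G_def c_def by auto
      then have "(\<integral>\<^sup>+s\<in>{0<..<t}. ennreal (G s powr (p - 1)) \<partial>lborel) = (\<integral>\<^sup>+s. 0 \<partial>(lborel :: real measure))"
        by (intro nn_integral_cong) (auto simp: indicator_def)
      then show ?thesis by simp
    next
      case False
      then have AB: "0 < A" "0 < B" using A B by auto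
      \<comment> \<open>Solves \<open>B = A * T powr (- (N / (2 * r)))\<close>: up to the kernel
        constant, the two bounds in \<open>G\<close> cross here. Both pieces of the integral then
        become multiples of the same \<open>D\<close>, a power of the product of norms.\<close>
      define T where "T = (A / B) powr (2 * r / N)"
      have T: "0 < T" using AB unfolding T_def by simp
      define D where "D = (A powr (r / rs) * B powr (1 - r / rs)) powr (p - 1)"
      have ex1: "r / rs * (p - 1) = 2 * r / N" unfolding rs using p N_pos by simp
      have ex2: "(1 - r / rs) * (p - 1) = p - 1 - 2 * r / N" unfolding left_diff_distrib ex1 by simp
      have D_eq: "D = A powr (2 * r / N) * B powr (p - 1 - 2 * r / N)"
        unfolding D_def powr_mult powr_powr ex1 ex2 ..
      have "\<delta> powr (p - 1) = 2 powr (- p) / b" unfolding \<delta>_def powr_powr using p b by simp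
      moreover have "D \<le> \<delta> powr (p - 1)" unfolding D_def using sm p by (intro powr_mono2) auto
      ultimately have "D * b \<le> 2 powr (- p) / b * b" using b by (intro mult_right_mono) auto
      then have Db: "D * b \<le> 2 powr (- p)" using b by simp
      have e1: "B powr (p - 1) * T = D"
        unfolding T_def D_eq powr_divide powr_diff by simp
      have e2: "A powr (p - 1) * T powr (1 - \<gamma>) = D"
      proof -
        have "2 * r / N * (1 - \<gamma>) = 2 * r / N - (p - 1)"
        proof -
          have "2 * r / N * \<gamma> = p - 1" unfolding \<gamma>_def rs using r N_pos by simp
          then show ?thesis unfolding right_diff_distrib by simp
        qed
        then show ?thesis unfolding T_def D_eq powr_powr using AB
          by (simp add: powr_divide powr_diff)
      qed
      have "(\<integral>\<^sup>+s\<in>{0<..<t}. ennreal (G s powr (p - 1)) \<partial>lborel)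
          \<le> (\<integral>\<^sup>+s. (ennreal (B powr (p - 1)) * indicator {0..T} s
               + ennreal (c powr (p - 1)) * (ennreal (s powr (- \<gamma>)) * indicator {T..} s)) \<partial>lborel)"
      proof (intro nn_integral_mono)
        fix s :: real
        show "ennreal (G s powr (p - 1)) * indicator {0<..<t} s \<le> ennreal (B powr (p - 1)) * indicator {0..T} s
               + ennreal (c powr (p - 1)) * (ennreal (s powr (- \<gamma>)) * indicator {T..} s)"
        proof (cases "0 < s \<and> s < t")
          case True
          show ?thesis
          proof (cases "s \<le> T")
            case sT: True
            have "G s powr (p - 1) \<le> B powr (p - 1)"
              using G0 p by (intro powr_mono2) (auto simp: G_def)
            then have "ennreal (G s powr (p - 1)) \<le> ennreal (B powr (p - 1))" by (rule ennreal_leI)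
            then show ?thesis using True sT by (auto intro: add_increasing2)
          next
            case False
            have "G s powr (p - 1) \<le> (c * s powr (- (N / (2 * r)))) powr (p - 1)"
              using G0 p by (intro powr_mono2) (auto simp: G_def)
            also have "\<dots> = c powr (p - 1) * s powr (- \<gamma>)"
              unfolding powr_mult powr_powr using \<gamma>_eq by simp
            finally have "ennreal (G s powr (p - 1)) \<le> ennreal (c powr (p - 1)) * ennreal (s powr (- \<gamma>))"
              by (simp add: ennreal_mult[symmetric] ennreal_leI)
            then show ?thesis using True False by simp
          qed
        qed simp
      qed
      also have "\<dots> = ennreal (B powr (p - 1)) * ennreal T
          + ennreal (c powr (p - 1)) * ennreal (T powr (1 - \<gamma>) / (\<gamma> - 1))"
        using T by (subst nn_integral_add, simp, simp, subst nn_integral_cmult, simp, subst nn_integral_cmult)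
           (auto simp: nn_integral_powr_atLeast[OF \<gamma> T])
      also have "\<dots> = ennreal (B powr (p - 1) * T + c powr (p - 1) * (T powr (1 - \<gamma>) / (\<gamma> - 1)))"
        using T \<gamma> by (subst ennreal_mult[symmetric], simp, simp, subst ennreal_mult[symmetric], simp, simp,
            subst ennreal_plus) auto
      also have "c powr (p - 1) * (T powr (1 - \<gamma>) / (\<gamma> - 1))
          = C powr ((p - 1) / r) * (A powr (p - 1) * T powr (1 - \<gamma>)) / (\<gamma> - 1)"
        unfolding c_def powr_mult powr_powr by (simp add: mult_ac)
      also have "B powr (p - 1) * T + C powr ((p - 1) / r) * (A powr (p - 1) * T powr (1 - \<gamma>)) / (\<gamma> - 1) = D * b"
        unfolding e1 e2 b_def by (simp add: algebra_simps)
      finally show ?thesis using Db by (auto intro: order_trans ennreal_leI)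
    qed
    have small: "ennreal (G t powr (1 - 1 / 1)) * (\<integral>\<^sup>+s\<in>{0<..<t}. ennreal (G s powr (p / 1 - 1)) \<partial>lborel)
        \<le> ennreal (2 powr (- p))" for t
    proof -
      \<comment> \<open>The exponent is 0 and \<open>0 powr 0 = 0\<close>, so the factor is 0 or
        1.\<close>
      have "ennreal (G t powr (1 - 1 / 1)) \<le> 1" by simp
      from mult_mono[OF this int[of t]] show ?thesis by simp
    qed
    have "\<exists>u. case_prod u \<in> borel_measurable (borel \<Otimes>\<^sub>M borel) \<and> (\<forall>t x. 0 \<le> u t x) \<and>
        (\<forall>t x. u t x \<le> 2 * profile 1 f t x) \<and>
        (\<forall>t x. ennreal (u t x) = S t (\<lambda>y. ennreal (f y)) x + duhamel p u t x)"
      using p G G0 small f0 by (intro mild_solution_exists[where G=G and B=B]) auto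
    moreover have "2 * profile 1 f t x \<le> 2 * c * t powr (- (N / (2 * r)))" if "0 < t" for t x
    proof -
      have "profile 1 f t x \<le> (c * t powr (- (N / (2 * r)))) powr (1 / 1)"
        using G2[OF that] c f0 by (intro profile_le_powr) auto
      then show ?thesis using c by simp
    qed
    ultimately show "decaying_mild_solution p 1 r f" unfolding decaying_mild_solution_def by blast
  qed
qed

text \<open>Chebyshev's inequality, through which the strong endpoint \<open>r = rs\<close> is
  reduced to the weak construction.\<close>

lemma distr_le_of_strong:
  assumes [measurable]: "f \<in> borel_measurable borel" and "\<And>x. 0 \<le> f x" "0 < r" "0 < \<tau>"
    and J: "(\<integral>\<^sup>+x. ennreal (f x powr r) \<partial>\<mu>) \<le> ennreal (A powr r)"
  shows "emeasure \<mu> {x. \<tau> < f x} \<le> ennreal ((A / \<tau>) powr r)"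
proof -
  have "emeasure \<mu> {x. \<tau> < f x} \<le> emeasure \<mu> {x \<in> UNIV. 1 \<le> ennreal (\<tau> powr (- r)) * ennreal (f x powr r)}"
  proof (intro emeasure_mono subsetI)
    fix x assume "x \<in> {x. \<tau> < f x}"
    then have "1 \<le> (f x / \<tau>) powr r" using assms by (intro ge_one_powr_ge_zero) auto
    also have "\<dots> = \<tau> powr (- r) * f x powr r" by (simp add: powr_divide powr_minus_divide)
    finally show "x \<in> {x \<in> UNIV. 1 \<le> ennreal (\<tau> powr (- r)) * ennreal (f x powr r)}"
      by (simp add: ennreal_mult[symmetric])
  next
    show "{x \<in> UNIV. 1 \<le> ennreal (\<tau> powr (- r)) * ennreal (f x powr r)} \<in> sets \<mu>"
      unfolding sets_mu by measurable
  qed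
  also have "\<dots> \<le> ennreal (\<tau> powr (- r)) * (\<integral>\<^sup>+x. ennreal (f x powr r) * indicator UNIV x \<partial>\<mu>)"
    by (rule nn_integral_Markov_inequality) (auto simp: sets_mu)
  also have "\<dots> \<le> ennreal (\<tau> powr (- r)) * ennreal (A powr r)"
    using J by (intro mult_left_mono) auto
  also have "\<dots> = ennreal ((A / \<tau>) powr r)"
    by (simp add: ennreal_mult[symmetric] powr_divide powr_minus_divide)
  finally show ?thesis .
qed

end

subsection \<open>Weighted norms\<close>

text \<open>Time must become the outer variable to match the Duhamel integral. As \<open>P\<close>
  need not be measurable, the exchange is made for a measurable null set \<open>Z\<close> containing
  the exceptions.\<close>

lemma AE_lborel_swap:
  assumes "AE z in (lborel :: ('a::euclidean_space \<times> 'b::euclidean_space) measure). P z"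
  shows "AE s in lborel. AE y in lborel. P (y, s)"
proof -
  have "AE z in (lborel :: 'a measure) \<Otimes>\<^sub>M (lborel :: 'b measure). P z"
    unfolding lborel_prod by (rule assms)
  then obtain Z where Z: "Z \<in> null_sets ((lborel :: 'a measure) \<Otimes>\<^sub>M (lborel :: 'b measure))"
      "{z \<in> space (lborel \<Otimes>\<^sub>M lborel). \<not> P z} \<subseteq> Z"
    unfolding eventually_ae_filter by auto
  have [measurable]: "Z \<in> sets ((lborel :: 'a measure) \<Otimes>\<^sub>M (lborel :: 'b measure))"
    using Z by auto
  have "AE y in (lborel :: 'a measure). AE s in (lborel :: 'b measure). (y, s) \<notin> Z"
    by (rule lborel_pair.AE_pair) (rule AE_not_in[OF Z(1)])
  then have "AE s in (lborel :: 'b measure). AE y in (lborel :: 'a measure). (y, s) \<notin> Z"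
    by (subst (asm) lborel_pair.AE_commute) measurable
  then show ?thesis
    by (rule eventually_mono, elim eventually_mono) (use Z(2) in \<open>auto simp: space_pair_measure\<close>)
qed

lemma AE_lebesgue_iff: "(AE x in lebesgue. P x) \<longleftrightarrow> (AE x in lborel. P x)"
  by (rule AE_completion_iff)

text \<open>The infimum is attained: take the bounds \<open>Linf f + 1 / (n + 1)\<close> and unite
  countably many null sets.\<close>

lemma AE_le_Linf: "AE x in lebesgue. ennreal \<bar>f x\<bar> \<le> Linf f"
proof (cases "Linf f = \<infinity>")
  case True
  then show ?thesis by simp
next
  case False
  have "AE x in lebesgue. ennreal \<bar>f x\<bar> \<le> Linf f + ennreal (1 / real (Suc n))" for n
  proof -
    have "Linf f < Linf f + ennreal (1 / real (Suc n))"
      using False ennreal_add_left_cancel_less[of "Linf f" 0 "ennreal (1 / real (Suc n))"] by simp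
    then obtain M where "AE x in lebesgue. ennreal \<bar>f x\<bar> \<le> M" "M < Linf f + ennreal (1 / real (Suc n))"
      unfolding Linf_def Inf_less_iff by auto
    then show ?thesis by (auto elim!: eventually_mono intro: order_trans less_imp_le)
  qed
  then have "AE x in lebesgue. \<forall>n. ennreal \<bar>f x\<bar> \<le> Linf f + ennreal (1 / real (Suc n))"
    by (simp add: AE_all_countable)
  then show ?thesis
  proof eventually_elim
    case (elim x)
    show ?case
    proof (rule ennreal_le_epsilon)
      fix e :: real assume "0 < e"
      then obtain n where "1 / real (Suc n) < e" using nat_approx_posE by blast
      then have "Linf f + ennreal (1 / real (Suc n)) \<le> Linf f + ennreal e"
        by (intro add_left_mono ennreal_leI) simp
      then show "ennreal \<bar>f x\<bar> \<le> Linf f + ennreal e" using elim order_trans by blast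
    qed
  qed
qed

lemma Linf_le: "AE x in lebesgue. \<bar>f x\<bar> \<le> M \<Longrightarrow> Linf f \<le> ennreal M"
  unfolding Linf_def by (intro Inf_lower) (auto elim!: eventually_mono intro: ennreal_leI)

text \<open>Clipping a Borel representative to \<open>[0, enn2real (Linf u0)]\<close> turns the a.e.
  bounds into the pointwise ones that the abstract lemmas ask for.\<close>

lemma bounded_borel_version:
  assumes "u0 \<in> borel_measurable lebesgue" "\<And>x. 0 \<le> u0 x" "Linf u0 < \<infinity>"
  obtains f where "f \<in> borel_measurable borel" "\<And>x. 0 \<le> f x" "\<And>x. f x \<le> enn2real (Linf u0)"
    "AE x in lborel. u0 x = f x"
proof -
  obtain g where g [measurable]: "g \<in> borel_measurable lborel" and ae: "AE x in lborel. u0 x = g x"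
    using completion_ex_borel_measurable_real[OF assms(1)] by blast
  define f where "f x = max 0 (min (enn2real (Linf u0)) (g x))" for x
  have g' [measurable]: "g \<in> borel_measurable borel" using g by simp
  have "AE x in lborel. u0 x = f x"
    using ae AE_le_Linf[of u0, unfolded AE_lebesgue_iff]
  proof eventually_elim
    case (elim x)
    have "ennreal (u0 x) \<le> ennreal (enn2real (Linf u0))"
      using elim(2) assms(2)[of x] assms(3) by (simp add: ennreal_enn2real)
    then have "u0 x \<le> enn2real (Linf u0)" by (subst (asm) ennreal_le_iff) auto
    then show ?case using elim(1) assms(2)[of x] unfolding f_def by simp
  qed
  moreover have "f \<in> borel_measurable borel" unfolding f_def by measurable
  ultimately show ?thesis by (intro that[of f]) (auto simp: f_def)
qed

lemma wweak_le:
  assumes "0 < q" "0 < E" and distr: "\<And>\<tau>. 0 < \<tau> \<Longrightarrow> wdistr w g \<tau> \<le> ennreal ((E / \<tau>) powr q)"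
  shows "wweak w q g \<le> ennreal E"
  unfolding wweak_def
proof (rule SUP_least)
  fix s :: real assume "s \<in> {0<..}"
  then have s: "0 < s" by simp
  \<comment> \<open>At this level the assumed distribution bound equals \<open>s\<close>, so
    \<open>l\<close> is admissible in the infimum defining the rearrangement.\<close>
  define l where "l = E * s powr (- (1 / q))"
  have l: "0 < l" using assms s unfolding l_def by simp
  have "E / l = s powr (1 / q)"
    unfolding l_def using assms s by (simp add: powr_minus divide_simps)
  then have "(E / l) powr q = s"
    using assms s by (simp add: powr_powr)
  then have "wdistr w g l \<le> ennreal s" using distr[OF l] by simp
  then have "wrearr w g s \<le> ennreal l" unfolding wrearr_def using l by (intro INF_lower) auto
  then have "ennreal (s powr (1 / q)) * wrearr w g s \<le> ennreal (s powr (1 / q)) * ennreal l"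
    by (rule mult_left_mono) simp
  also have "\<dots> = ennreal (s powr (1 / q) * l)"
    using l by (simp add: ennreal_mult[symmetric])
  also have "s powr (1 / q) * l = E"
    unfolding l_def using s by (simp add: powr_minus divide_simps)
  finally show "ennreal (s powr (1 / q)) * wrearr w g s \<le> ennreal E" .
qed

text \<open>Measurability matters because \<open>emeasure\<close> is 0 on non-measurable sets, which
  would break monotonicity.\<close>

lemma wdistr_antimono:
  assumes "g \<in> borel_measurable lebesgue" "l \<le> l'"
  shows "wdistr w g l' \<le> wdistr w g l"
proof -
  have "{x \<in> space lebesgue. l < \<bar>g x\<bar>} \<in> sets lebesgue"
    using assms(1) by measurable
  then have "{x. l < \<bar>g x\<bar>} \<in> sets lebesgue" by simp
  then show ?thesis unfolding wdistr_def
    using assms(2) by (intro emeasure_mono) (auto simp: wmeas_def)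
qed

text \<open>At \<open>s = (\<delta> / \<tau>) powr q\<close> the strict inequality forces the
  rearrangement strictly below \<open>\<tau>\<close>, hence some admissible level lies below
  \<open>\<tau>\<close>. With a non-strict bound the infimum might equal \<open>\<tau>\<close>
  without such a level being at hand.\<close>

lemma wdistr_le_of_wweak:
  assumes "g \<in> borel_measurable lebesgue" and less: "wweak w q g < ennreal \<delta>" and "0 < q" "0 < \<tau>" "0 < \<delta>"
  shows "wdistr w g \<tau> \<le> ennreal ((\<delta> / \<tau>) powr q)"
proof -
  define s where "s = (\<delta> / \<tau>) powr q"
  have s: "0 < s" using assms unfolding s_def by simp
  have "s powr (1 / q) = \<delta> / \<tau>" using assms unfolding s_def by (simp add: powr_powr)
  moreover have "ennreal (s powr (1 / q)) * wrearr w g s \<le> wweak w q g"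
    unfolding wweak_def using s by (intro SUP_upper) auto
  ultimately have *: "ennreal (\<delta> / \<tau>) * wrearr w g s < ennreal \<delta>" using less by simp
  have "wrearr w g s < ennreal \<tau>"
  proof (rule ccontr)
    assume "\<not> wrearr w g s < ennreal \<tau>"
    then have "ennreal (\<delta> / \<tau>) * ennreal \<tau> \<le> ennreal (\<delta> / \<tau>) * wrearr w g s"
      by (intro mult_left_mono) auto
    moreover have "ennreal (\<delta> / \<tau>) * ennreal \<tau> = ennreal \<delta>"
      using assms by (simp add: ennreal_mult[symmetric])
    ultimately show False using * by simp
  qed
  then obtain l where "0 < l" "wdistr w g l \<le> ennreal s" "ennreal l < ennreal \<tau>"
    unfolding wrearr_def INF_less_iff by auto
  then show ?thesis
    using wdistr_antimono[OF assms(1), of l \<tau> w] unfolding s_def by (auto intro: order_trans simp: ennreal_less_iff)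
qed

lemma wLnorm_le:
  assumes "(\<integral>\<^sup>+x. ennreal (\<bar>g x\<bar> powr q) \<partial>wmeas w) \<le> ennreal (E powr q)" "0 < q" "0 \<le> E"
  shows "wLnorm w q g \<le> ennreal E"
proof -
  define I where "I = (\<integral>\<^sup>+x. ennreal (\<bar>g x\<bar> powr q) \<partial>wmeas w)"
  have I: "I \<le> ennreal (E powr q)" using assms unfolding I_def by simp
  then have fin: "I \<noteq> \<infinity>" by (auto simp: top_unique)
  have "enn2real I powr (1 / q) \<le> (E powr q) powr (1 / q)"
    using I assms by (intro powr_mono2 enn2real_leI) auto
  then have "enn2real I powr (1 / q) \<le> E" using assms by (simp add: powr_powr)
  then show ?thesis using fin unfolding wLnorm_def Let_def I_def[symmetric] by (simp add: ennreal_leI)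
qed

lemma nn_integral_eq_wLnorm:
  assumes "wLnorm w q g < \<infinity>" "0 < q"
  shows "(\<integral>\<^sup>+x. ennreal (\<bar>g x\<bar> powr q) \<partial>wmeas w) = ennreal (enn2real (wLnorm w q g) powr q)"
proof -
  define I where "I = (\<integral>\<^sup>+x. ennreal (\<bar>g x\<bar> powr q) \<partial>wmeas w)"
  have fin: "I \<noteq> \<infinity>" using assms(1) unfolding wLnorm_def I_def[symmetric] Let_def by (auto split: if_splits)
  then have "enn2real (wLnorm w q g) = enn2real I powr (1 / q)"
    unfolding wLnorm_def I_def[symmetric] Let_def by simp
  then have "enn2real (wLnorm w q g) powr q = enn2real I" using assms(2) by (simp add: powr_powr)
  then show ?thesis using fin unfolding I_def[symmetric] by (simp add: ennreal_enn2real less_top)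
qed

subsection \<open>Solutions for the weighted Lebesgue measure\<close>

text \<open>Both weights enter only through the homogeneous dimension \<open>N\<close> in the kernel
  bound; \<open>weighted_heat_kernelI\<close> derives that bound and the sign of
  \<open>\<Gamma>\<close> from the Gaussian estimates.\<close>

locale weighted_heat_kernel =
  fixes w :: "'a::euclidean_space \<Rightarrow> real" and \<Gamma> :: "'a \<Rightarrow> 'a \<Rightarrow> real \<Rightarrow> real" and C N :: real
  assumes w_measurable [measurable]: "w \<in> borel_measurable borel"
    and w_nonneg: "\<And>x. 0 \<le> w x"
    and conds: "kernel_conds w \<Gamma>"
    and \<Gamma>_nonneg: "\<And>x y t. 0 < t \<Longrightarrow> 0 \<le> \<Gamma> x y t"
    and \<Gamma>_le: "\<And>x y t. 0 < t \<Longrightarrow> \<Gamma> x y t \<le> C * t powr (- (N / 2))"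
    and C_pos': "0 < C" and N_pos': "0 < N"
begin

abbreviation \<mu> :: "'a measure" where "\<mu> \<equiv> density lborel (\<lambda>x. ennreal (w x))"
abbreviation K :: "real \<Rightarrow> 'a \<Rightarrow> 'a \<Rightarrow> ennreal" where
  "K t x y \<equiv> (if 0 < t then ennreal (\<Gamma> x y t) else 0)"

text \<open>Continuity is available only for positive times. The indicator of that open set extends
  the kernel by 0 to a Borel function, and the coordinates are then permuted to put time in
  front.\<close>

lemma K_meas: "(\<lambda>(t, x, y). K t x y) \<in> borel_measurable (borel \<Otimes>\<^sub>M borel \<Otimes>\<^sub>M borel)"
proof -
  have op: "open (UNIV \<times> UNIV \<times> {0<..} :: ('a \<times> 'a \<times> real) set)"
    by (intro open_Times) auto
  have "continuous_on (UNIV \<times> UNIV \<times> {0<..}) (\<lambda>(x, y, t). \<Gamma> x y t)"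
    using conds unfolding kernel_conds_def by blast
  from borel_measurable_continuous_on_indicator[OF borel_open[OF op] this]
  have "(\<lambda>z. indicator (UNIV \<times> UNIV \<times> {0<..}) z *\<^sub>R (case z of (x, y, t) \<Rightarrow> \<Gamma> x y t))
      \<in> borel_measurable (borel \<Otimes>\<^sub>M borel \<Otimes>\<^sub>M borel)"
    by (simp add: borel_prod)
  then have "(\<lambda>\<omega>. (\<lambda>z. indicator (UNIV \<times> UNIV \<times> {0<..}) z *\<^sub>R (case z of (x, y, t) \<Rightarrow> \<Gamma> x y t))
       (fst (snd \<omega>), snd (snd \<omega>), fst \<omega>)) \<in> borel_measurable (borel \<Otimes>\<^sub>M borel \<Otimes>\<^sub>M borel)"
    by (rule measurable_compose[rotated]) measurable
  then have "(\<lambda>\<omega>. ennreal (indicator {0<..} (fst \<omega>) *\<^sub>R \<Gamma> (fst (snd \<omega>)) (snd (snd \<omega>)) (fst \<omega>)))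
       \<in> borel_measurable (borel \<Otimes>\<^sub>M borel \<Otimes>\<^sub>M borel)"
    by (simp add: indicator_times)
  also have "(\<lambda>\<omega>. ennreal (indicator {0<..} (fst \<omega>) *\<^sub>R \<Gamma> (fst (snd \<omega>)) (snd (snd \<omega>)) (fst \<omega>)))
      = (\<lambda>(t, x, y). K t x y)"
    by (auto simp: fun_eq_iff indicator_def)
  finally show ?thesis .
qed

lemma \<Gamma>_measurable:
  assumes "0 < t"
  shows "(\<lambda>y. ennreal (\<Gamma> x y t)) \<in> borel_measurable borel" "(\<lambda>y. ennreal (\<Gamma> y x t)) \<in> borel_measurable borel"
proof -
  have "(\<lambda>y. (\<lambda>(t, x, y). K t x y) (t, x, y)) \<in> borel_measurable borel"
    by (rule measurable_compose[OF _ K_meas]) measurable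
  then show "(\<lambda>y. ennreal (\<Gamma> x y t)) \<in> borel_measurable borel" using assms by simp
  have "(\<lambda>y. (\<lambda>(t, x, y). K t x y) (t, y, x)) \<in> borel_measurable borel"
    by (rule measurable_compose[OF _ K_meas]) measurable
  then show "(\<lambda>y. ennreal (\<Gamma> y x t)) \<in> borel_measurable borel" using assms by simp
qed

sublocale heat_kernel \<mu> K C N
proof (intro heat_kernel.intro heat_kernel_axioms.intro)
  show "sigma_finite_measure \<mu>"
    by (subst sigma_finite_measure.sigma_finite_iff_density_finite[OF sigma_finite_lborel]) auto
  show "sets \<mu> = sets borel" by simp
  show "(\<lambda>(t, x, y). K t x y) \<in> borel_measurable (borel \<Otimes>\<^sub>M borel \<Otimes>\<^sub>M borel)" by (rule K_meas)
  show "0 < C" "0 < N" by (rule C_pos' N_pos')+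
  show "K t x y = 0" if "t \<le> 0" for t x y using that by simp
  show "K t x y \<le> ennreal (C * t powr - (N / 2))" if "0 < t" for t x y
    using that \<Gamma>_le by (simp add: ennreal_leI)
  show "AE x in \<mu>. P x" if "AE x in lborel. P x" for P
    using that by (subst AE_density) auto
  fix t :: real and x y :: 'a assume t: "0 < t"
  have "(\<integral>\<^sup>+\<eta>. ennreal (\<Gamma> x \<eta> t * w \<eta>) \<partial>lborel) = 1" "(\<integral>\<^sup>+\<xi>. ennreal (\<Gamma> \<xi> y t * w \<xi>) \<partial>lborel) = 1"
    using conds t unfolding kernel_conds_def nn_integral_completion by blast+
  then show "(\<integral>\<^sup>+y. K t x y \<partial>\<mu>) = 1" "(\<integral>\<^sup>+x. K t x y \<partial>\<mu>) = 1"
    using t \<Gamma>_measurable[OF t] by (simp_all add: nn_integral_density ennreal_mult \<Gamma>_nonneg w_nonneg mult.commute)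
  fix s :: real assume s: "0 < s"
  have st: "0 < t \<and> t < s + t" using s t by simp
  have "ennreal (\<Gamma> x y (s + t)) = (\<integral>\<^sup>+\<xi>. ennreal (\<Gamma> x \<xi> (s + t - t) * \<Gamma> \<xi> y t * w \<xi>) \<partial>lborel)"
    using conds st unfolding kernel_conds_def nn_integral_completion by blast
  also have "\<dots> = (\<integral>\<^sup>+z. K s x z * K t z y \<partial>\<mu>)"
    using t s \<Gamma>_measurable[OF t] \<Gamma>_measurable[OF s]
    by (simp add: nn_integral_density ennreal_mult \<Gamma>_nonneg w_nonneg mult_ac)
  finally show "K (s + t) x y = (\<integral>\<^sup>+z. K s x z * K t z y \<partial>\<mu>)" using s t by simp
qed

lemma lebesgue_integral_eq_S:
  assumes [measurable]: "h \<in> borel_measurable borel" and h: "\<And>y. 0 \<le> h y"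
    and ae: "AE y in lborel. g y = h y" and t: "0 < t"
  shows "(\<integral>\<^sup>+y. ennreal (\<Gamma> x y t * g y * w y) \<partial>lebesgue) = S t (\<lambda>y. ennreal (h y)) x"
proof -
  note [measurable] = \<Gamma>_measurable[OF t]
  have "(\<integral>\<^sup>+y. ennreal (\<Gamma> x y t * g y * w y) \<partial>lebesgue) = (\<integral>\<^sup>+y. ennreal (\<Gamma> x y t * h y * w y) \<partial>lborel)"
    unfolding nn_integral_completion
    by (intro nn_integral_cong_AE, use ae in \<open>rule eventually_mono\<close>) simp
  also have "\<dots> = S t (\<lambda>y. ennreal (h y)) x"
    unfolding S_def using t
    by (simp add: nn_integral_density ennreal_mult \<Gamma>_nonneg w_nonneg h mult_ac)
  finally show ?thesis .
qed

text \<open>Changing the solution on a null set of \<open>y\<close> for a.e. \<open>s\<close> leaves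
  the nonlinear term untouched at every \<open>(t, x)\<close>, so a Borel representative can be used
  in the equation at all times.\<close>

lemma lebesgue_integral_eq_duhamel:
  assumes [measurable]: "case_prod v \<in> borel_measurable (borel \<Otimes>\<^sub>M borel)" and v: "\<And>s y. 0 \<le> v s y"
    and ae: "AE s in lborel. 0 < s \<longrightarrow> (AE y in lborel. u y s = v s y)"
  shows "(\<integral>\<^sup>+s\<in>{0<..<t}. (\<integral>\<^sup>+y. ennreal (\<Gamma> x y (t - s) * u y s powr p * w y) \<partial>lebesgue) \<partial>lebesgue)
      = duhamel p v t x"
proof -
  have "(\<integral>\<^sup>+s\<in>{0<..<t}. (\<integral>\<^sup>+y. ennreal (\<Gamma> x y (t - s) * u y s powr p * w y) \<partial>lebesgue) \<partial>lborel)
      = duhamel p v t x"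
    unfolding duhamel_def
  proof (intro nn_integral_cong_AE, use ae in \<open>rule eventually_mono\<close>)
    fix s assume s: "0 < s \<longrightarrow> (AE y in lborel. u y s = v s y)"
    show "(\<integral>\<^sup>+y. ennreal (\<Gamma> x y (t - s) * u y s powr p * w y) \<partial>lebesgue) * indicator {0<..<t} s
        = S (t - s) (\<lambda>y. ennreal (v s y powr p)) x * indicator {0<..} s"
    proof (cases "0 < s \<and> s < t")
      case True
      then have "AE y in lborel. u y s powr p = v s y powr p" using s by (auto elim: eventually_mono)
      then have "(\<integral>\<^sup>+y. ennreal (\<Gamma> x y (t - s) * u y s powr p * w y) \<partial>lebesgue)
          = S (t - s) (\<lambda>y. ennreal (v s y powr p)) x"
        using True by (intro lebesgue_integral_eq_S) auto
      then show ?thesis using True by simp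
    next
      case False
      then show ?thesis by (auto simp: indicator_def S_nonpos)
    qed
  qed
  then show ?thesis by (simp only: nn_integral_completion)
qed

lemma global_solutionI:
  assumes [measurable]: "case_prod v \<in> borel_measurable (borel \<Otimes>\<^sub>M borel)" and v: "\<And>s y. 0 \<le> v s y" "\<And>s y. v s y \<le> M"
    and f [measurable]: "f \<in> borel_measurable borel" "\<And>y. 0 \<le> f y" "AE y in lborel. u0 y = f y"
    and eq: "\<And>t x. 0 < t \<Longrightarrow> ennreal (v t x) = S t (\<lambda>y. ennreal (f y)) x + duhamel p v t x"
  shows "global_solution w \<Gamma> p u0 (\<lambda>x t. v t x)"
  unfolding global_solution_def is_solution_def
proof (intro conjI ballI allI)
  show "0 \<le> v t x" for x t by (rule v)
  have "(\<lambda>z. indicator (UNIV \<times> {0<..}) z *\<^sub>R v (snd z) (fst z)) \<in> borel_measurable (borel \<Otimes>\<^sub>M borel)"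
    by measurable
  then have "(\<lambda>z::'a \<times> real. indicator (UNIV \<times> {0<..}) z *\<^sub>R v (snd z) (fst z)) \<in> borel_measurable lborel"
    by (simp add: borel_prod)
  then show "set_borel_measurable lebesgue (UNIV \<times> {0<..}) (\<lambda>z. v (snd z) (fst z))"
    unfolding set_borel_measurable_def by (rule measurable_completion)
  show "v t \<in> borel_measurable lebesgue" for t
    by (rule measurable_completion) measurable
  show "\<exists>M. AE z in lebesgue. z \<in> UNIV \<times> {0<..} \<longrightarrow> \<bar>v (snd z) (fst z)\<bar> \<le> M"
    using v by (intro exI[of _ M] always_eventually) auto
  fix t :: real assume "t \<in> {0<..}"
  then have t: "0 < t" by simp
  show "AE x in lebesgue. ennreal (v t x) =
          (\<integral>\<^sup>+ y. ennreal (\<Gamma> x y t * u0 y * w y) \<partial>lebesgue) +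
          (\<integral>\<^sup>+ s\<in>{0<..<t}. (\<integral>\<^sup>+ y. ennreal (\<Gamma> x y (t - s) * v s y powr p * w y) \<partial>lebesgue) \<partial>lebesgue)"
    by (intro always_eventually allI)
       (simp add: eq[OF t] lebesgue_integral_eq_S[OF f(1) f(2) f(3) t]
          lebesgue_integral_eq_duhamel[where u="\<lambda>x t. v t x", OF assms(1) v(1)])
qed

text \<open>The representative \<open>v\<close> enters only the Duhamel term; the left-hand side
  keeps \<open>u\<close>, since the equation at a given \<open>t\<close> concerns a single slice,
  which a product null set may hide.\<close>

lemma global_solution_borel_version:
  assumes u: "global_solution w \<Gamma> p u0 u"
  obtains v M where "case_prod v \<in> borel_measurable (borel \<Otimes>\<^sub>M borel)" "\<And>s y. 0 \<le> v s y" "\<And>s y. v s y \<le> M"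
    "AE s in lborel. 0 < s \<longrightarrow> (AE y in lborel. u y s = v s y)"
    "\<And>t. 0 < t \<Longrightarrow> AE x in lborel. ennreal (u x t) = (\<integral>\<^sup>+ y. ennreal (\<Gamma> x y t * u0 y * w y) \<partial>lebesgue) + duhamel p v t x"
proof -
  define g where "g z = indicator (UNIV \<times> {0<..}) z *\<^sub>R u (fst z) (snd z)" for z :: "'a \<times> real"
  have g: "g \<in> borel_measurable lebesgue"
    using u unfolding global_solution_def is_solution_def set_borel_measurable_def g_def by blast
  then obtain g' where g' [measurable]: "g' \<in> borel_measurable lborel" and gg': "AE z in lborel. g z = g' z"
    using completion_ex_borel_measurable_real by blast
  obtain M where M: "AE z in lborel. z \<in> UNIV \<times> {0<..} \<longrightarrow> \<bar>u (fst z) (snd z)\<bar> \<le> M"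
    using u unfolding global_solution_def is_solution_def AE_lebesgue_iff by blast
  \<comment> \<open>Clipping makes both bounds hold everywhere; \<open>max 0 M\<close> guards
    against a negative \<open>M\<close>.\<close>
  define v where "v s y = max 0 (min (max 0 M) (g' (y, s)))" for s y
  have [measurable]: "g' \<in> borel_measurable (borel \<Otimes>\<^sub>M borel)" using g' by (simp add: borel_prod)
  have v_meas: "case_prod v \<in> borel_measurable (borel \<Otimes>\<^sub>M borel)" unfolding v_def by measurable
  have nn: "0 \<le> u y s" if "0 < s" for y s
    using u that unfolding global_solution_def is_solution_def by auto
  have "AE z in lborel. snd z > 0 \<longrightarrow> u (fst z) (snd z) = v (snd z) (fst z)"
    using gg' M
  proof eventually_elim
    case (elim z)
    show ?case
    proof
      assume z: "0 < snd z"
      then have "z \<in> UNIV \<times> {0<..}" by (cases z) auto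
      then have "g' z = u (fst z) (snd z)" "\<bar>u (fst z) (snd z)\<bar> \<le> M"
        using elim unfolding g_def by auto
      then show "u (fst z) (snd z) = v (snd z) (fst z)"
        using nn[OF z, of "fst z"] unfolding v_def by simp
    qed
  qed
  from AE_lborel_swap[OF this]
  have ae: "AE s in lborel. 0 < s \<longrightarrow> (AE y in lborel. u y s = v s y)"
    by (rule eventually_mono) auto
  show ?thesis
  proof (rule that[OF v_meas _ _ ae])
    show "0 \<le> v s y" "v s y \<le> max 0 M" for s y unfolding v_def by auto
    fix t :: real assume t: "0 < t"
    have "AE x in lborel. ennreal (u x t) =
          (\<integral>\<^sup>+ y. ennreal (\<Gamma> x y t * u0 y * w y) \<partial>lebesgue) +
          (\<integral>\<^sup>+ s\<in>{0<..<t}. (\<integral>\<^sup>+ y. ennreal (\<Gamma> x y (t - s) * u y s powr p * w y) \<partial>lebesgue) \<partial>lebesgue)"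
      using u t unfolding global_solution_def is_solution_def AE_lebesgue_iff by auto
    moreover have "0 \<le> v s y" for s y unfolding v_def by auto
    note lebesgue_integral_eq_duhamel[OF v_meas this ae]
    ultimately show "AE x in lborel. ennreal (u x t) = (\<integral>\<^sup>+ y. ennreal (\<Gamma> x y t * u0 y * w y) \<partial>lebesgue) + duhamel p v t x"
      by simp
  qed
qed

text \<open>The one-sided comparison is applied twice with the roles exchanged, each time with the
  bound of the solution on the left.\<close>

lemma global_solution_unique:
  assumes "global_solution w \<Gamma> p u0 u" "global_solution w \<Gamma> p u0 v" and p: "1 \<le> p" and t: "0 < t"
  shows "AE x in lebesgue. u x t = v x t"
proof -
  obtain u' M where u': "case_prod u' \<in> borel_measurable (borel \<Otimes>\<^sub>M borel)" "\<And>s y. 0 \<le> u' s y" "\<And>s y. u' s y \<le> M"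
    "AE s in lborel. 0 < s \<longrightarrow> (AE y in lborel. u y s = u' s y)"
    "\<And>t. 0 < t \<Longrightarrow> AE x in lborel. ennreal (u x t) = (\<integral>\<^sup>+ y. ennreal (\<Gamma> x y t * u0 y * w y) \<partial>lebesgue) + duhamel p u' t x"
    using global_solution_borel_version[OF assms(1)] by blast
  obtain v' M' where v': "case_prod v' \<in> borel_measurable (borel \<Otimes>\<^sub>M borel)" "\<And>s y. 0 \<le> v' s y" "\<And>s y. v' s y \<le> M'"
    "AE s in lborel. 0 < s \<longrightarrow> (AE y in lborel. v y s = v' s y)"
    "\<And>t. 0 < t \<Longrightarrow> AE x in lborel. ennreal (v x t) = (\<integral>\<^sup>+ y. ennreal (\<Gamma> x y t * u0 y * w y) \<partial>lebesgue) + duhamel p v' t x"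
    using global_solution_borel_version[OF assms(2)] by blast
  have nn: "0 \<le> u x t" "0 \<le> v x t" if "0 < t" for x t
    using assms(1,2) that unfolding global_solution_def is_solution_def by auto
  define a where "a t x = (\<integral>\<^sup>+ y. ennreal (\<Gamma> x y t * u0 y * w y) \<partial>lebesgue)" for t x
  have "AE x in lborel. u x t \<le> v x t"
    by (rule mild_solution_le[where U="\<lambda>t x. u x t" and V="\<lambda>t x. v x t" and u=u' and v=v' and a=a and M=M and p=p])
       (use u' v' nn p t in \<open>auto simp: a_def\<close>)
  moreover have "AE x in lborel. v x t \<le> u x t"
    by (rule mild_solution_le[where U="\<lambda>t x. v x t" and V="\<lambda>t x. u x t" and u=v' and v=u' and a=a and M=M' and p=p])
       (use u' v' nn p t in \<open>auto simp: a_def\<close>)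
  ultimately show ?thesis unfolding AE_lebesgue_iff by eventually_elim simp
qed

lemma nn_integral_wmeas:
  fixes g h :: "'a \<Rightarrow> ennreal"
  assumes "h \<in> borel_measurable borel" "g \<in> borel_measurable lebesgue" "AE x in lborel. g x = h x"
  shows "(\<integral>\<^sup>+x. g x \<partial>wmeas w) = (\<integral>\<^sup>+x. h x \<partial>\<mu>)"
proof -
  have w: "(\<lambda>x. ennreal (w x)) \<in> borel_measurable lebesgue"
    by (rule measurable_completion) measurable
  have "(\<integral>\<^sup>+x. g x \<partial>wmeas w) = (\<integral>\<^sup>+x. ennreal (w x) * g x \<partial>lborel)"
    unfolding wmeas_def nn_integral_density[OF w assms(2)] nn_integral_completion ..
  also have "\<dots> = (\<integral>\<^sup>+x. ennreal (w x) * h x \<partial>lborel)"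
    using assms(3) by (intro nn_integral_cong_AE) (auto elim: eventually_mono)
  also have "\<dots> = (\<integral>\<^sup>+x. h x \<partial>\<mu>)"
    using assms(1) by (simp add: nn_integral_density)
  finally show ?thesis .
qed

lemma wdistr_eq:
  fixes g h :: "'a \<Rightarrow> real"
  assumes h [measurable]: "h \<in> borel_measurable borel" "\<And>x. 0 \<le> h x"
    and g: "g \<in> borel_measurable lebesgue" and ae: "AE x in lborel. g x = h x"
  shows "wdistr w g \<tau> = emeasure \<mu> {x. \<tau> < h x}"
proof -
  have "{x \<in> space lebesgue. \<tau> < \<bar>g x\<bar>} \<in> sets lebesgue" using g by measurable
  then have A: "{x. \<tau> < \<bar>g x\<bar>} \<in> sets lebesgue" by simp
  have "wdistr w g \<tau> = (\<integral>\<^sup>+x. indicator {x. \<tau> < \<bar>g x\<bar>} x \<partial>wmeas w)"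
    unfolding wdistr_def using A by (subst nn_integral_indicator) (auto simp: wmeas_def)
  also have "\<dots> = (\<integral>\<^sup>+x. indicator {x. \<tau> < h x} x \<partial>\<mu>)"
  proof (rule nn_integral_wmeas)
    show "indicator {x. \<tau> < \<bar>g x\<bar>} \<in> borel_measurable lebesgue" using A by simp
    show "AE x in lborel. indicator {x. \<tau> < \<bar>g x\<bar>} x = (indicator {x. \<tau> < h x} x :: ennreal)"
      using ae by eventually_elim (use h(2) in \<open>auto simp: indicator_def\<close>)
  qed measurable
  also have "\<dots> = emeasure \<mu> {x. \<tau> < h x}" by (rule nn_integral_indicator) measurable
  finally show ?thesis .
qed

lemma nn_integral_powr_wmeas:
  fixes g h :: "'a \<Rightarrow> real"
  assumes h [measurable]: "h \<in> borel_measurable borel" "\<And>x. 0 \<le> h x"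
    and g [measurable]: "g \<in> borel_measurable lebesgue" and ae: "AE x in lborel. g x = h x"
  shows "(\<integral>\<^sup>+x. ennreal (\<bar>g x\<bar> powr q) \<partial>wmeas w) = (\<integral>\<^sup>+x. ennreal (h x powr q) \<partial>\<mu>)"
proof (rule nn_integral_wmeas)
  show "AE x in lborel. ennreal (\<bar>g x\<bar> powr q) = ennreal (h x powr q)"
    using ae by eventually_elim (use h(2) in auto)
qed measurable

section \<open>Decay estimates by interpolation\<close>

lemma decay_exponent:
  assumes "0 < r" "r \<le> q" "0 < D" "0 < E" "0 < t"
  shows "(1 + t) powr (N / 2 * (1 / r - 1 / q)) * (E powr (r / q) * (D * (1 + t) powr (- (N / (2 * r)))) powr (1 - r / q))
    = E powr (r / q) * D powr (1 - r / q)"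
proof -
  have "N / 2 * (1 / r - 1 / q) + - (N / (2 * r)) * (1 - r / q) = 0"
    using assms by (simp add: field_simps)
  then have "(1 + t) powr (N / 2 * (1 / r - 1 / q)) * (1 + t) powr (- (N / (2 * r)) * (1 - r / q)) = 1"
    using assms unfolding powr_add[symmetric] by simp
  then show ?thesis unfolding powr_mult powr_powr by (simp add: mult_ac)
qed

text \<open>Interpolation between weak \<open>r\<close> and the sup bound \<open>M\<close>: for
  \<open>\<tau> < M\<close> multiply the distribution bound by
  \<open>(M / \<tau>) powr (q - r)\<close>, which is at least 1; for larger \<open>\<tau>\<close>
  the level set is empty.\<close>

lemma wweak_decay:
  assumes r: "0 < r" "r \<le> q" and D: "0 < D" and E: "0 < E" and t: "0 < t"
    and h [measurable]: "h \<in> borel_measurable borel" "\<And>x. 0 \<le> h x"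
    and g: "g \<in> borel_measurable lebesgue" and ae: "AE x in lborel. g x = h x"
    and le: "\<And>x. h x \<le> D * (1 + t) powr (- (N / (2 * r)))"
    and distr: "\<And>\<tau>. 0 < \<tau> \<Longrightarrow> emeasure \<mu> {x. \<tau> < h x} \<le> ennreal ((E / \<tau>) powr r)"
  shows "ennreal ((1 + t) powr (N / 2 * (1 / r - 1 / q))) * wweak w q g \<le> ennreal (E powr (r / q) * D powr (1 - r / q))"
proof -
  define M where "M = D * (1 + t) powr (- (N / (2 * r)))"
  have M: "0 < M" using D t unfolding M_def by simp
  have "wweak w q g \<le> ennreal (E powr (r / q) * M powr (1 - r / q))"
  proof (rule wweak_le)
    show "0 < q" "0 < E powr (r / q) * M powr (1 - r / q)" using r E M by auto
    fix \<tau> :: real assume \<tau>: "0 < \<tau>"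
    show "wdistr w g \<tau> \<le> ennreal ((E powr (r / q) * M powr (1 - r / q) / \<tau>) powr q)"
    proof (cases "\<tau> < M")
      case True
      have "(E / \<tau>) powr r = (E / \<tau>) powr r * 1" by simp
      also have "\<dots> \<le> (E / \<tau>) powr r * (M / \<tau>) powr (q - r)"
        using True \<tau> r by (intro mult_left_mono ge_one_powr_ge_zero) auto
      also have "\<dots> = E powr r * M powr (q - r) / (\<tau> powr r * \<tau> powr (q - r))"
        by (simp add: powr_divide)
      also have "\<tau> powr r * \<tau> powr (q - r) = \<tau> powr q" by (simp add: powr_add[symmetric])
      also have "E powr r * M powr (q - r) / \<tau> powr q = (E powr (r / q) * M powr (1 - r / q) / \<tau>) powr q"
      proof -
        have "(1 - r / q) * q = q - r" using r by (simp add: field_simps)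
        then show ?thesis unfolding powr_divide powr_mult powr_powr using r by simp
      qed
      finally show ?thesis
        unfolding wdistr_eq[OF h g ae] using distr[OF \<tau>] by (auto intro: order_trans ennreal_leI)
    next
      case False
      then have "{x. \<tau> < h x} = {}" using le unfolding M_def by (auto simp: not_less intro: order_trans)
      then show ?thesis unfolding wdistr_eq[OF h g ae] by simp
    qed
  qed
  then have "ennreal ((1 + t) powr (N / 2 * (1 / r - 1 / q))) * wweak w q g
      \<le> ennreal ((1 + t) powr (N / 2 * (1 / r - 1 / q))) * ennreal (E powr (r / q) * M powr (1 - r / q))"
    by (rule mult_left_mono) simp
  also have "\<dots> = ennreal (E powr (r / q) * D powr (1 - r / q))"
    unfolding M_def decay_exponent[OF r D E t, symmetric] by (simp add: ennreal_mult)
  finally show ?thesis .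
qed

text \<open>Interpolation by \<open>h powr q \<le> M powr (q - r) * h powr r\<close>, where
  \<open>M\<close> is the decaying sup bound; the powers of \<open>1 + t\<close> cancel by
  \<open>decay_exponent\<close>.\<close>

lemma wLnorm_decay:
  assumes r: "0 < r" "r \<le> q" and D: "0 < D" and E: "0 < E" and t: "0 < t"
    and h [measurable]: "h \<in> borel_measurable borel" "\<And>x. 0 \<le> h x"
    and g: "g \<in> borel_measurable lebesgue" and ae: "AE x in lborel. g x = h x"
    and le: "\<And>x. h x \<le> D * (1 + t) powr (- (N / (2 * r)))"
    and J: "(\<integral>\<^sup>+x. ennreal (h x powr r) \<partial>\<mu>) \<le> ennreal (E powr r)"
  shows "ennreal ((1 + t) powr (N / 2 * (1 / r - 1 / q))) * wLnorm w q g \<le> ennreal (E powr (r / q) * D powr (1 - r / q))"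
proof -
  define M where "M = D * (1 + t) powr (- (N / (2 * r)))"
  have M: "0 < M" using D t unfolding M_def by simp
  have "wLnorm w q g \<le> ennreal (E powr (r / q) * M powr (1 - r / q))"
  proof (rule wLnorm_le)
    show "0 < q" "0 \<le> E powr (r / q) * M powr (1 - r / q)" using r by auto
    have "(\<integral>\<^sup>+x. ennreal (\<bar>g x\<bar> powr q) \<partial>wmeas w) = (\<integral>\<^sup>+x. ennreal (h x powr q) \<partial>\<mu>)"
      by (rule nn_integral_powr_wmeas[OF h g ae])
    also have "\<dots> \<le> (\<integral>\<^sup>+x. ennreal (M powr (q - r)) * ennreal (h x powr r) \<partial>\<mu>)"
    proof (rule nn_integral_mono)
      fix x
      have "h x powr q = h x powr (q - r) * h x powr r" by (simp add: powr_add[symmetric])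
      also have "\<dots> \<le> M powr (q - r) * h x powr r"
      proof (cases "q = r")
        case True
        then show ?thesis using M by auto
      next
        case False
        then show ?thesis using r h(2) le by (intro mult_right_mono powr_mono2) (auto simp: M_def)
      qed
      finally show "ennreal (h x powr q) \<le> ennreal (M powr (q - r)) * ennreal (h x powr r)"
        by (simp add: ennreal_mult[symmetric] ennreal_leI)
    qed
    also have "\<dots> = ennreal (M powr (q - r)) * (\<integral>\<^sup>+x. ennreal (h x powr r) \<partial>\<mu>)"
      by (rule nn_integral_cmult) measurable
    also have "\<dots> \<le> ennreal (M powr (q - r)) * ennreal (E powr r)"
      by (intro mult_left_mono J) auto
    also have "\<dots> = ennreal ((E powr (r / q) * M powr (1 - r / q)) powr q)"
    proof -
      have "(1 - r / q) * q = q - r" using r by (simp add: field_simps)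
      then show ?thesis unfolding powr_mult powr_powr using r by (simp add: ennreal_mult mult.commute)
    qed
    finally show "(\<integral>\<^sup>+x. ennreal (\<bar>g x\<bar> powr q) \<partial>wmeas w) \<le> ennreal ((E powr (r / q) * M powr (1 - r / q)) powr q)" .
  qed
  then have "ennreal ((1 + t) powr (N / 2 * (1 / r - 1 / q))) * wLnorm w q g
      \<le> ennreal ((1 + t) powr (N / 2 * (1 / r - 1 / q))) * ennreal (E powr (r / q) * M powr (1 - r / q))"
    by (rule mult_left_mono) simp
  also have "\<dots> = ennreal (E powr (r / q) * D powr (1 - r / q))"
    unfolding M_def decay_exponent[OF r D E t, symmetric] by (simp add: ennreal_mult)
  finally show ?thesis .
qed

lemma Linf_decay:
  assumes t: "0 < t" and D: "0 < D" and h: "\<And>x. 0 \<le> h x" and ae: "AE x in lborel. g x = h x"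
    and le: "\<And>x. h x \<le> D * (1 + t) powr (- (N / (2 * r)))"
  shows "ennreal ((1 + t) powr (N / 2 * (1 / r))) * Linf g \<le> ennreal D"
proof -
  have "Linf g \<le> ennreal (D * (1 + t) powr (- (N / (2 * r))))"
  proof (rule Linf_le)
    show "AE x in lebesgue. \<bar>g x\<bar> \<le> D * (1 + t) powr (- (N / (2 * r)))"
      unfolding AE_lebesgue_iff using ae by eventually_elim (use h le in auto)
  qed
  then have "ennreal ((1 + t) powr (N / 2 * (1 / r))) * Linf g
      \<le> ennreal ((1 + t) powr (N / 2 * (1 / r))) * ennreal (D * (1 + t) powr (- (N / (2 * r))))"
    by (rule mult_left_mono) simp
  also have "\<dots> = ennreal (D * ((1 + t) powr (N / 2 * (1 / r)) * (1 + t) powr (- (N / (2 * r)))))"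
    using D by (simp add: ennreal_mult[symmetric] mult_ac)
  also have "(1 + t) powr (N / 2 * (1 / r)) * (1 + t) powr (- (N / (2 * r))) = 1"
    using t by (simp add: powr_add[symmetric])
  finally show ?thesis by simp
qed

lemma SUP_finite:
  fixes F :: "real \<Rightarrow> ennreal"
  assumes "\<And>t. 0 < t \<Longrightarrow> F t \<le> ennreal c"
  shows "(SUP t\<in>{0<..}. F t) < \<infinity>"
proof -
  have "(SUP t\<in>{0<..}. F t) \<le> ennreal c" using assms by (intro SUP_least) auto
  then show ?thesis by (auto intro: le_less_trans)
qed

text \<open>By uniqueness every global solution agrees with the constructed \<open>v\<close> at each
  positive time, so the decay claims about arbitrary solutions become claims about
  \<open>v\<close>.\<close>

lemma solution_of_mild:
  assumes p: "1 \<le> p" and k: "1 \<le> k"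
    and f: "f \<in> borel_measurable borel" "\<And>x. 0 \<le> f x" "\<And>x. f x \<le> B" "AE x in lborel. u0 x = f x"
    and v: "case_prod v \<in> borel_measurable (borel \<Otimes>\<^sub>M borel)" "\<And>t x. 0 \<le> v t x"
      "\<And>t x. v t x \<le> 2 * profile k f t x"
      "\<And>t x. ennreal (v t x) = S t (\<lambda>y. ennreal (f y)) x + duhamel p v t x"
  shows "\<exists>u. global_solution w \<Gamma> p u0 u"
    and "global_solution w \<Gamma> p u0 u \<Longrightarrow> 0 < t \<Longrightarrow> AE x in lborel. u x t = v t x"
    and "0 < t \<Longrightarrow> v t x \<le> 2 * B"
proof -
  have B: "0 \<le> B" using f order_trans by blast
  have v_le: "v t x \<le> 2 * B" for t x
  proof (cases "0 < t")
    case True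
    then show ?thesis using v(3)[of t x] profile_le[of f B k t x] f k by force
  next
    \<comment> \<open>The profile is 0 here. Times \<open>t \<le> 0\<close> are covered because
      \<open>global_solutionI\<close> wants a bound at all times.\<close>
    case False
    then show ?thesis using v(3)[of t x] B unfolding profile_def by (simp add: S_nonpos)
  qed
  then show "0 < t \<Longrightarrow> v t x \<le> 2 * B" by simp
  have sol: "global_solution w \<Gamma> p u0 (\<lambda>x t. v t x)"
    by (rule global_solutionI[OF v(1,2) v_le f(1,2,4) v(4)])
  then show "\<exists>u. global_solution w \<Gamma> p u0 u" by blast
  show "AE x in lborel. u x t = v t x" if "global_solution w \<Gamma> p u0 u" "0 < t"
    using global_solution_unique[OF that(1) sol p that(2)] unfolding AE_lebesgue_iff .
qed

section \<open>The two assertions for a fixed weight\<close>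

lemma weak_theorem:
  assumes p: "1 < p" and rs: "rs = N / 2 * (p - 1)" "1 < rs"
  shows "\<exists>\<delta>>0. \<forall>u0. u0 \<in> borel_measurable lebesgue \<and> (\<forall>x. 0 \<le> u0 x) \<and> Linf u0 < \<infinity> \<and>
        wweak w rs u0 < ennreal \<delta> \<longrightarrow>
      (\<exists>u. global_solution w \<Gamma> p u0 u) \<and>
      (\<forall>u v. global_solution w \<Gamma> p u0 u \<longrightarrow> global_solution w \<Gamma> p u0 v \<longrightarrow>
         (\<forall>t>0. AE x in lebesgue. u x t = v x t)) \<and>
      (\<forall>u. global_solution w \<Gamma> p u0 u \<longrightarrow>
         (\<forall>q. rs \<le> q \<longrightarrow>
            (SUP t\<in>{0<..}. ennreal ((1 + t) powr (N / 2 * (1 / rs - 1 / q)))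
                             * wweak w q (\<lambda>x. u x t)) < \<infinity>) \<and>
         (SUP t\<in>{0<..}. ennreal ((1 + t) powr (N / 2 * (1 / rs)))
                          * Linf (\<lambda>x. u x t)) < \<infinity>)"
proof -
  obtain \<delta> k where \<delta>: "0 < \<delta>" and k: "1 < k" "k < rs" and ex: "\<forall>f B. f \<in> borel_measurable borel \<longrightarrow>
      (\<forall>x. 0 \<le> f x) \<longrightarrow> (\<forall>x. f x \<le> B) \<longrightarrow>
      (\<forall>\<tau>>0. emeasure \<mu> {x. \<tau> < f x} \<le> ennreal ((\<delta> / \<tau>) powr rs)) \<longrightarrow> decaying_mild_solution p k rs f"
    using small_weak_solution[OF p rs] by blast
  show ?thesis
  proof (intro exI[of _ \<delta>] conjI allI impI \<delta>)
    fix u0 :: "'a \<Rightarrow> real"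
    assume u0: "u0 \<in> borel_measurable lebesgue \<and> (\<forall>x. 0 \<le> u0 x) \<and> Linf u0 < \<infinity> \<and> wweak w rs u0 < ennreal \<delta>"
    obtain f where f: "f \<in> borel_measurable borel" "\<And>x. 0 \<le> f x" "\<And>x. f x \<le> enn2real (Linf u0)"
        "AE x in lborel. u0 x = f x"
      using bounded_borel_version[of u0] u0 by blast
    have distr: "emeasure \<mu> {x. \<tau> < f x} \<le> ennreal ((\<delta> / \<tau>) powr rs)" if "0 < \<tau>" for \<tau>
      using wdistr_le_of_wweak[of u0 w rs \<delta> \<tau>] wdistr_eq[OF f(1,2) _ f(4)] u0 rs(2) that \<delta> by simp
    have "decaying_mild_solution p k rs f" using ex f distr by blast
    then obtain v c where
      v: "case_prod v \<in> borel_measurable (borel \<Otimes>\<^sub>M borel)" "\<And>t x. 0 \<le> v t x"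
      "\<And>t x. v t x \<le> 2 * profile k f t x"
      "\<And>t x. ennreal (v t x) = S t (\<lambda>y. ennreal (f y)) x + duhamel p v t x"
      and c: "\<And>t x. 0 < t \<Longrightarrow> 2 * profile k f t x \<le> c * t powr (- (N / (2 * rs)))"
      unfolding decaying_mild_solution_def by blast
    have p1: "1 \<le> p" and k1: "1 \<le> k" using p k by auto
    note sol = solution_of_mild[OF p1 k1 f v]
    show "\<exists>u. global_solution w \<Gamma> p u0 u" by (rule sol(1))
    show "AE x in lebesgue. u x t = v x t"
      if "global_solution w \<Gamma> p u0 u" "global_solution w \<Gamma> p u0 v" "0 < t" for u v t
      using global_solution_unique[OF that(1,2) p1 that(3)] .
    have "v t x \<le> c * t powr (- (N / (2 * rs)))" if "0 < t" for t x
      using v(3) c[OF that] order_trans by blast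
    \<comment> \<open>The sup bound \<open>2 * enn2real (Linf u0)\<close> serves short times and the
      power of \<open>t\<close> long ones; together they give decay in \<open>1 + t\<close>.\<close>
    then obtain D where D: "0 < D" "\<And>t x. 0 < t \<Longrightarrow> v t x \<le> D * (1 + t) powr (- (N / (2 * rs)))"
      using decay_combine[of "N / (2 * rs)" v "2 * enn2real (Linf u0)" c] sol(3) N_pos rs(2) by auto
    obtain E where E: "0 < E" "\<And>t \<tau>. 0 < t \<Longrightarrow> 0 < \<tau> \<Longrightarrow> emeasure \<mu> {x. \<tau> < 2 * profile k f t x} \<le> ennreal ((E / \<tau>) powr rs)"
      using profile_weak_distr[OF f(1,2,3) k1 k(2) \<delta> distr] by blast
    have vm [measurable]: "v t \<in> borel_measurable borel" for t
      using measurable_compose[OF measurable_Pair1' v(1)] by simp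
    note [measurable] = f(1)
    have v_distr: "emeasure \<mu> {x. \<tau> < v t x} \<le> ennreal ((E / \<tau>) powr rs)" if "0 < t" "0 < \<tau>" for t \<tau>
    proof -
      have [measurable]: "(\<lambda>x. profile k f t x) \<in> borel_measurable borel" unfolding profile_def by measurable
      have "emeasure \<mu> {x. \<tau> < v t x} \<le> emeasure \<mu> {x. \<tau> < 2 * profile k f t x}"
        using v(3) by (intro emeasure_mono) (auto intro: less_le_trans)
      then show ?thesis using E(2)[OF that] order_trans by blast
    qed
    fix u assume u: "global_solution w \<Gamma> p u0 u"
    have um: "(\<lambda>x. u x t) \<in> borel_measurable lebesgue" if "0 < t" for t
      using u that unfolding global_solution_def is_solution_def by auto
    show "(SUP t\<in>{0<..}. ennreal ((1 + t) powr (N / 2 * (1 / rs - 1 / q))) * wweak w q (\<lambda>x. u x t)) < \<infinity>"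
      if q: "rs \<le> q" for q
    proof (rule SUP_finite)
      fix t :: real assume t: "0 < t"
      have "0 < rs" using rs(2) by simp
      from wweak_decay[OF this q D(1) E(1) t vm v(2) um[OF t] sol(2)[OF u t] D(2)[OF t] v_distr[OF t]]
      show "ennreal ((1 + t) powr (N / 2 * (1 / rs - 1 / q))) * wweak w q (\<lambda>x. u x t)
          \<le> ennreal (E powr (rs / q) * D powr (1 - rs / q))" .
    qed
    show "(SUP t\<in>{0<..}. ennreal ((1 + t) powr (N / 2 * (1 / rs))) * Linf (\<lambda>x. u x t)) < \<infinity>"
    proof (rule SUP_finite)
      fix t :: real assume t: "0 < t"
      show "ennreal ((1 + t) powr (N / 2 * (1 / rs))) * Linf (\<lambda>x. u x t) \<le> ennreal D"
        by (rule Linf_decay[OF t D(1) v(2) sol(2)[OF u t] D(2)[OF t]])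
    qed
  qed
qed

lemma strong_theorem:
  assumes p: "1 < p" and rs: "rs = N / 2 * (p - 1)" "1 < rs" and r: "1 \<le> r" "r \<le> rs"
  shows "\<exists>\<delta>>0. \<forall>u0. u0 \<in> borel_measurable lebesgue \<and> (\<forall>x. 0 \<le> u0 x) \<and> Linf u0 < \<infinity> \<and>
          wLnorm w r u0 < \<infinity> \<and>
          enn2real (wLnorm w r u0) powr (r / rs) * enn2real (Linf u0) powr (1 - r / rs) < \<delta> \<longrightarrow>
        (\<exists>u. global_solution w \<Gamma> p u0 u) \<and>
        (\<forall>u v. global_solution w \<Gamma> p u0 u \<longrightarrow> global_solution w \<Gamma> p u0 v \<longrightarrow>
           (\<forall>t>0. AE x in lebesgue. u x t = v x t)) \<and>
        (\<forall>u. global_solution w \<Gamma> p u0 u \<longrightarrow>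
           (\<forall>q. r \<le> q \<longrightarrow>
              (SUP t\<in>{0<..}. ennreal ((1 + t) powr (N / 2 * (1 / r - 1 / q)))
                               * wLnorm w q (\<lambda>x. u x t)) < \<infinity>) \<and>
           (SUP t\<in>{0<..}. ennreal ((1 + t) powr (N / 2 * (1 / r)))
                            * Linf (\<lambda>x. u x t)) < \<infinity>)"
proof -
  have "\<exists>\<delta>>0. \<exists>k. 1 \<le> k \<and> k \<le> r \<and> (\<forall>f A B. f \<in> borel_measurable borel \<longrightarrow> (\<forall>x. 0 \<le> f x) \<longrightarrow>
      (\<forall>x. f x \<le> B) \<longrightarrow> 0 \<le> A \<longrightarrow> (\<integral>\<^sup>+x. ennreal (f x powr r) \<partial>\<mu>) \<le> ennreal (A powr r) \<longrightarrow>
      A powr (r / rs) * B powr (1 - r / rs) < \<delta> \<longrightarrow> decaying_mild_solution p k r f)"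
  proof (cases "r = rs")
    case False
    then have "r < rs" using r by simp
    then show ?thesis using small_strong_solution[OF p rs(1) r(1)] r(1) by blast
  next
    case True
    obtain \<delta> k where \<delta>: "0 < \<delta>" and k: "1 < k" "k < rs" and ex: "\<forall>f B. f \<in> borel_measurable borel \<longrightarrow>
        (\<forall>x. 0 \<le> f x) \<longrightarrow> (\<forall>x. f x \<le> B) \<longrightarrow>
        (\<forall>\<tau>>0. emeasure \<mu> {x. \<tau> < f x} \<le> ennreal ((\<delta> / \<tau>) powr rs)) \<longrightarrow> decaying_mild_solution p k rs f"
      using small_weak_solution[OF p rs] by blast
    show ?thesis
    proof (rule exI[of _ \<delta>], rule conjI[OF \<delta>], rule exI[of _ k], intro conjI allI impI)
      show "1 \<le> k" "k \<le> r" using k True by auto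
      fix f :: "'a \<Rightarrow> real" and A B
      assume f: "f \<in> borel_measurable borel" "\<forall>x. 0 \<le> f x" "\<forall>x. f x \<le> B" and A: "0 \<le> A"
        and J: "(\<integral>\<^sup>+x. ennreal (f x powr r) \<partial>\<mu>) \<le> ennreal (A powr r)"
        and sm: "A powr (r / rs) * B powr (1 - r / rs) < \<delta>"
      have distr: "emeasure \<mu> {x. \<tau> < f x} \<le> ennreal ((\<delta> / \<tau>) powr rs)" if \<tau>: "0 < \<tau>" for \<tau>
      proof (cases "B = 0")
        \<comment> \<open>Here \<open>0 powr 0 = 0\<close> makes the smallness hypothesis say
          nothing about \<open>A\<close>, but \<open>f\<close> vanishes.\<close>
        case B: True
        have "f x < \<tau>" for x using f(3) \<tau> unfolding B by (meson le_less_trans)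
        then have "{x. \<tau> < f x} = {}" by (auto dest: less_asym)
        then show ?thesis by (simp only: emeasure_empty zero_le)
      next
        case False
        then have "A < \<delta>" using sm A rs(2) True by simp
        have "emeasure \<mu> {x. \<tau> < f x} \<le> ennreal ((A / \<tau>) powr r)"
          using f J \<tau> r by (intro distr_le_of_strong) auto
        also have "\<dots> \<le> ennreal ((\<delta> / \<tau>) powr rs)"
          using \<open>A < \<delta>\<close> A \<tau> r True by (intro ennreal_leI) (auto intro!: powr_mono2 divide_right_mono)
        finally show ?thesis .
      qed
      then show "decaying_mild_solution p k r f" using ex f unfolding True by blast
    qed
  qed
  then obtain \<delta> k where \<delta>: "0 < \<delta>" and k: "1 \<le> k" "k \<le> r" and ex: "\<forall>f A B. f \<in> borel_measurable borel \<longrightarrow>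
      (\<forall>x. 0 \<le> f x) \<longrightarrow> (\<forall>x. f x \<le> B) \<longrightarrow> 0 \<le> A \<longrightarrow>
      (\<integral>\<^sup>+x. ennreal (f x powr r) \<partial>\<mu>) \<le> ennreal (A powr r) \<longrightarrow>
      A powr (r / rs) * B powr (1 - r / rs) < \<delta> \<longrightarrow> decaying_mild_solution p k r f"
    by blast
  show ?thesis
  proof (intro exI[of _ \<delta>] conjI allI impI \<delta>)
    fix u0 :: "'a \<Rightarrow> real"
    assume u0: "u0 \<in> borel_measurable lebesgue \<and> (\<forall>x. 0 \<le> u0 x) \<and> Linf u0 < \<infinity> \<and> wLnorm w r u0 < \<infinity> \<and>
          enn2real (wLnorm w r u0) powr (r / rs) * enn2real (Linf u0) powr (1 - r / rs) < \<delta>"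
    obtain f where f: "f \<in> borel_measurable borel" "\<And>x. 0 \<le> f x" "\<And>x. f x \<le> enn2real (Linf u0)"
        "AE x in lborel. u0 x = f x"
      using bounded_borel_version[of u0] u0 by blast
    define A where "A = enn2real (wLnorm w r u0)"
    have A: "0 \<le> A" unfolding A_def by simp
    have J: "(\<integral>\<^sup>+x. ennreal (f x powr r) \<partial>\<mu>) \<le> ennreal (A powr r)"
      using nn_integral_powr_wmeas[OF f(1,2) _ f(4), of r] nn_integral_eq_wLnorm[of w r u0] u0 r
      unfolding A_def by simp
    have "A powr (r / rs) * enn2real (Linf u0) powr (1 - r / rs) < \<delta>" using u0 unfolding A_def by simp
    then have "decaying_mild_solution p k r f" using ex f A J by blast
    then obtain v c where
      v: "case_prod v \<in> borel_measurable (borel \<Otimes>\<^sub>M borel)" "\<And>t x. 0 \<le> v t x"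
      "\<And>t x. v t x \<le> 2 * profile k f t x"
      "\<And>t x. ennreal (v t x) = S t (\<lambda>y. ennreal (f y)) x + duhamel p v t x"
      and c: "\<And>t x. 0 < t \<Longrightarrow> 2 * profile k f t x \<le> c * t powr (- (N / (2 * r)))"
      unfolding decaying_mild_solution_def by blast
    have p1: "1 \<le> p" using p by auto
    note sol = solution_of_mild[OF p1 k(1) f v]
    show "\<exists>u. global_solution w \<Gamma> p u0 u" by (rule sol(1))
    show "AE x in lebesgue. u x t = v x t"
      if "global_solution w \<Gamma> p u0 u" "global_solution w \<Gamma> p u0 v" "0 < t" for u v t
      using global_solution_unique[OF that(1,2) p1 that(3)] .
    have "v t x \<le> c * t powr (- (N / (2 * r)))" if "0 < t" for t x
      using v(3) c[OF that] order_trans by blast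
    then obtain D where D: "0 < D" "\<And>t x. 0 < t \<Longrightarrow> v t x \<le> D * (1 + t) powr (- (N / (2 * r)))"
      using decay_combine[of "N / (2 * r)" v "2 * enn2real (Linf u0)" c] sol(3) N_pos r by auto
    have vm: "v t \<in> borel_measurable borel" for t
      using measurable_compose[OF measurable_Pair1' v(1)] by simp
    \<comment> \<open>The added 1 keeps \<open>E\<close> positive when the datum vanishes.\<close>
    define E where "E = 2 * A + 1"
    have E: "0 < E" using A unfolding E_def by simp
    have v_int: "(\<integral>\<^sup>+x. ennreal (v t x powr r) \<partial>\<mu>) \<le> ennreal (E powr r)" if "0 < t" for t
    proof -
      have "(\<integral>\<^sup>+x. ennreal (v t x powr r) \<partial>\<mu>) \<le> (\<integral>\<^sup>+x. ennreal ((2 * profile k f t x) powr r) \<partial>\<mu>)"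
        using v r by (intro nn_integral_mono ennreal_leI powr_mono2) auto
      also have "\<dots> \<le> ennreal ((2 * A) powr r)"
        by (rule profile_strong[OF f(1,2,3) k A that J])
      also have "\<dots> \<le> ennreal (E powr r)"
        using A r unfolding E_def by (intro ennreal_leI powr_mono2) auto
      finally show ?thesis .
    qed
    fix u assume u: "global_solution w \<Gamma> p u0 u"
    have um: "(\<lambda>x. u x t) \<in> borel_measurable lebesgue" if "0 < t" for t
      using u that unfolding global_solution_def is_solution_def by auto
    show "(SUP t\<in>{0<..}. ennreal ((1 + t) powr (N / 2 * (1 / r - 1 / q))) * wLnorm w q (\<lambda>x. u x t)) < \<infinity>"
      if q: "r \<le> q" for q
    proof (rule SUP_finite)
      fix t :: real assume t: "0 < t"
      have "0 < r" using r by simp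
      from wLnorm_decay[OF this q D(1) E t vm v(2) um[OF t] sol(2)[OF u t] D(2)[OF t] v_int[OF t]]
      show "ennreal ((1 + t) powr (N / 2 * (1 / r - 1 / q))) * wLnorm w q (\<lambda>x. u x t)
          \<le> ennreal (E powr (r / q) * D powr (1 - r / q))" .
    qed
    show "(SUP t\<in>{0<..}. ennreal ((1 + t) powr (N / 2 * (1 / r))) * Linf (\<lambda>x. u x t)) < \<infinity>"
    proof (rule SUP_finite)
      fix t :: real assume t: "0 < t"
      show "ennreal ((1 + t) powr (N / 2 * (1 / r))) * Linf (\<lambda>x. u x t) \<le> ennreal D"
        by (rule Linf_decay[OF t D(1) v(2) sol(2)[OF u t] D(2)[OF t]])
    qed
  qed
qed

end

subsection \<open>Growth of balls for the two weights\<close>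

text \<open>A quarter-radius ball on which the weight is at least
  \<open>(\<rho> / 4) powr \<alpha>\<close> already has weighted volume of order
  \<open>\<rho> powr (n + \<alpha>)\<close>. The upper bound \<open>M\<close> ensures finiteness,
  because \<open>measure\<close> is 0 on sets of infinite measure.\<close>

lemma measure_wmeas_ball_ge:
  fixes w :: "'a::euclidean_space \<Rightarrow> real"
  assumes [measurable]: "w \<in> borel_measurable borel" and w: "\<And>y. 0 \<le> w y" and \<rho>: "0 < \<rho>"
    and up: "\<And>y. y \<in> ball x \<rho> \<Longrightarrow> w y \<le> M"
    and sub: "ball z (\<rho> / 4) \<subseteq> ball x \<rho>"
    and low: "\<And>y. y \<in> ball z (\<rho> / 4) \<Longrightarrow> (\<rho> / 4) powr \<alpha> \<le> w y"
  shows "unit_ball_vol (real DIM('a)) * (1 / 4) powr (real DIM('a) + \<alpha>) * \<rho> powr (real DIM('a) + \<alpha>)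
      \<le> measure (wmeas w) (ball x \<rho>)"
proof -
  have eq: "emeasure (wmeas w) (ball x \<rho>) = (\<integral>\<^sup>+y. ennreal (w y) * indicator (ball x \<rho>) y \<partial>lborel)"
    unfolding wmeas_def
    by (subst emeasure_density) (auto simp: nn_integral_completion intro!: measurable_completion)
  have "emeasure (wmeas w) (ball x \<rho>) \<le> (\<integral>\<^sup>+y. ennreal M * indicator (ball x \<rho>) y \<partial>lborel)"
    unfolding eq using up by (intro nn_integral_mono) (auto simp: indicator_def intro!: ennreal_leI)
  also have "\<dots> = ennreal M * emeasure lborel (ball x \<rho>)"
    by (rule nn_integral_cmult_indicator) simp
  also have "\<dots> < \<infinity>" using \<rho> by (simp add: emeasure_ball ennreal_mult_less_top)
  finally have fin: "emeasure (wmeas w) (ball x \<rho>) < \<infinity>" .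
  define c where "c = (\<rho> / 4) powr \<alpha> * (unit_ball_vol (real DIM('a)) * (\<rho> / 4) ^ DIM('a))"
  have "ennreal c = ennreal ((\<rho> / 4) powr \<alpha>) * emeasure lborel (ball z (\<rho> / 4))"
    using \<rho> unfolding c_def by (subst emeasure_ball) (auto simp: ennreal_mult)
  also have "\<dots> = (\<integral>\<^sup>+y. ennreal ((\<rho> / 4) powr \<alpha>) * indicator (ball z (\<rho> / 4)) y \<partial>lborel)"
    by (rule nn_integral_cmult_indicator[symmetric]) simp
  also have "\<dots> \<le> emeasure (wmeas w) (ball x \<rho>)"
    unfolding eq using low sub by (intro nn_integral_mono) (auto simp: indicator_def intro!: ennreal_leI)
  finally have "c \<le> measure (wmeas w) (ball x \<rho>)"
    using fin by (simp add: emeasure_eq_ennreal_measure)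
  moreover have "c = unit_ball_vol (real DIM('a)) * (1 / 4) powr (real DIM('a) + \<alpha>) * \<rho> powr (real DIM('a) + \<alpha>)"
  proof -
    have "\<rho> / 4 = 1 / 4 * \<rho>" by simp
    then have "(1 / 4) powr (real DIM('a) + \<alpha>) * \<rho> powr (real DIM('a) + \<alpha>) = (\<rho> / 4) powr (real DIM('a) + \<alpha>)"
      by (simp only: powr_mult)
    also have "\<dots> = (\<rho> / 4) ^ DIM('a) * (\<rho> / 4) powr \<alpha>"
      using \<rho> by (simp add: powr_add powr_realpow)
    finally show ?thesis unfolding c_def by (simp add: mult_ac)
  qed
  ultimately show ?thesis by simp
qed

lemma weightA_facts:
  fixes i :: "'n::finite" and x :: "real^'n"
  assumes "0 \<le> \<alpha>"
  shows "weightA i \<alpha> \<in> borel_measurable borel" "0 \<le> weightA i \<alpha> x"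
    and "0 < \<rho> \<Longrightarrow> y \<in> ball x \<rho> \<Longrightarrow> weightA i \<alpha> y \<le> 1 + (norm x + \<rho>) powr \<alpha>"
    and "0 < \<rho> \<Longrightarrow> \<exists>z. ball z (\<rho> / 4) \<subseteq> ball x \<rho> \<and> (\<forall>y\<in>ball z (\<rho> / 4). (\<rho> / 4) powr \<alpha> \<le> weightA i \<alpha> y)"
proof -
  have [measurable]: "(\<lambda>x::real^'n. x $ i) \<in> borel_measurable borel"
    by (intro borel_measurable_continuous_onI continuous_intros)
  show "weightA i \<alpha> \<in> borel_measurable borel"
    unfolding weightA_def[abs_def] by measurable
  show "0 \<le> weightA i \<alpha> x" unfolding weightA_def by simp
next
  assume \<rho>: "0 < \<rho>" and y: "y \<in> ball x \<rho>"
  have "norm y \<le> norm x + \<rho>"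
    using y norm_triangle_ineq2[of y x] by (simp add: dist_norm norm_minus_commute)
  then have "\<bar>y $ i\<bar> \<le> norm x + \<rho>" using component_le_norm_cart[of y i] by linarith
  then have "\<bar>y $ i\<bar> powr \<alpha> \<le> (norm x + \<rho>) powr \<alpha>" using assms by (intro powr_mono2) auto
  then show "weightA i \<alpha> y \<le> 1 + (norm x + \<rho>) powr \<alpha>" unfolding weightA_def by auto
next
  assume \<rho>: "0 < \<rho>"
  \<comment> \<open>Moving half a radius away from the hyperplane where the weight vanishes leaves
    distance at least \<open>\<rho> / 4\<close> to it throughout the smaller ball.\<close>
  define z where "z = x + (if 0 \<le> x $ i then \<rho> / 2 else - (\<rho> / 2)) *\<^sub>R axis i 1"
  have dz: "dist x z = \<rho> / 2" unfolding z_def dist_norm using \<rho> by (simp add: norm_axis_1)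
  have zi: "\<rho> / 2 \<le> \<bar>z $ i\<bar>" unfolding z_def using \<rho> by (simp add: axis_def)
  have "(\<rho> / 4) powr \<alpha> \<le> weightA i \<alpha> y" if y: "y \<in> ball z (\<rho> / 4)" for y
  proof (cases "\<alpha> = 0")
    case True
    then show ?thesis using \<rho> unfolding weightA_def by simp
  next
    case False
    have "\<bar>(z - y) $ i\<bar> < \<rho> / 4"
      using y component_le_norm_cart[of "z - y" i] by (simp add: dist_norm)
    then have "\<rho> / 4 \<le> \<bar>y $ i\<bar>" using zi unfolding vector_minus_component by linarith
    then show ?thesis unfolding weightA_def using False assms \<rho> by (simp add: powr_mono2)
  qed
  moreover have "ball z (\<rho> / 4) \<subseteq> ball x \<rho>"
  proof
    fix y assume "y \<in> ball z (\<rho> / 4)"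
    then show "y \<in> ball x \<rho>" using dist_triangle[of x y z] dz \<rho> by simp
  qed
  ultimately show "\<exists>z. ball z (\<rho> / 4) \<subseteq> ball x \<rho> \<and> (\<forall>y\<in>ball z (\<rho> / 4). (\<rho> / 4) powr \<alpha> \<le> weightA i \<alpha> y)"
    by blast
qed

lemma weightB_facts:
  fixes x :: "'a::euclidean_space"
  assumes "0 \<le> \<alpha>"
  shows "(weightB \<alpha> :: 'a \<Rightarrow> real) \<in> borel_measurable borel" "0 \<le> weightB \<alpha> x"
    and "0 < \<rho> \<Longrightarrow> y \<in> ball x \<rho> \<Longrightarrow> weightB \<alpha> y \<le> 1 + (norm x + \<rho>) powr \<alpha>"
    and "0 < \<rho> \<Longrightarrow> \<exists>z. ball z (\<rho> / 4) \<subseteq> ball x \<rho> \<and> (\<forall>y\<in>ball z (\<rho> / 4). (\<rho> / 4) powr \<alpha> \<le> weightB \<alpha> y)"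
proof -
  show "(weightB \<alpha> :: 'a \<Rightarrow> real) \<in> borel_measurable borel"
    unfolding weightB_def[abs_def] by measurable
  show "0 \<le> weightB \<alpha> x" unfolding weightB_def by simp
next
  assume \<rho>: "0 < \<rho>" and y: "y \<in> ball x \<rho>"
  have "norm y \<le> norm x + \<rho>"
    using y norm_triangle_ineq2[of y x] by (simp add: dist_norm norm_minus_commute)
  then have "norm y powr \<alpha> \<le> (norm x + \<rho>) powr \<alpha>" using assms by (intro powr_mono2) auto
  then show "weightB \<alpha> y \<le> 1 + (norm x + \<rho>) powr \<alpha>" unfolding weightB_def by auto
next
  assume \<rho>: "0 < \<rho>"
  \<comment> \<open>A radial direction, along which \<open>z\<close> moves away from the origin; at
    \<open>x = 0\<close> any unit vector will do.\<close>
  obtain e where e: "norm e = 1" "norm x *\<^sub>R e = x"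
  proof (cases "x = 0")
    case True
    obtain b :: 'a where "b \<in> Basis" using nonempty_Basis by blast
    then show ?thesis using that[of b] True by simp
  next
    case False
    then show ?thesis using that[of "x /\<^sub>R norm x"] by simp
  qed
  define z where "z = x + (\<rho> / 2) *\<^sub>R e"
  have dz: "dist x z = \<rho> / 2" unfolding z_def dist_norm using \<rho> e by simp
  have "z = (norm x + \<rho> / 2) *\<^sub>R e" unfolding z_def scaleR_add_left e(2) ..
  then have zn: "\<rho> / 2 \<le> norm z" using \<rho> e by simp
  have "(\<rho> / 4) powr \<alpha> \<le> weightB \<alpha> y" if y: "y \<in> ball z (\<rho> / 4)" for y
  proof (cases "\<alpha> = 0")
    case True
    then show ?thesis using \<rho> unfolding weightB_def by simp
  next
    case False
    have "norm (z - y) < \<rho> / 4" using y by (simp add: dist_norm)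
    then have "\<rho> / 4 \<le> norm y" using zn norm_triangle_ineq2[of z y] by linarith
    then show ?thesis unfolding weightB_def using False assms \<rho> by (simp add: powr_mono2)
  qed
  moreover have "ball z (\<rho> / 4) \<subseteq> ball x \<rho>"
  proof
    fix y assume "y \<in> ball z (\<rho> / 4)"
    then show "y \<in> ball x \<rho>" using dist_triangle[of x y z] dz \<rho> by simp
  qed
  ultimately show "\<exists>z. ball z (\<rho> / 4) \<subseteq> ball x \<rho> \<and> (\<forall>y\<in>ball z (\<rho> / 4). (\<rho> / 4) powr \<alpha> \<le> weightB \<alpha> y)"
    by blast
qed

text \<open>The lower Gaussian bound is positive and the square root is nonnegative, which forces
  \<open>\<Gamma> \<ge> 0\<close>. In the upper bound the exponential is at most 1, and both balls
  of radius \<open>sqrt t\<close> have measure at least \<open>v * sqrt t powr N\<close>.\<close>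

lemma weighted_heat_kernelI:
  fixes w :: "'a::euclidean_space \<Rightarrow> real"
  assumes w: "w \<in> borel_measurable borel" "\<And>x. 0 \<le> w x" and kernel: "kernel_conds w \<Gamma>"
    and N: "0 < N" and v: "0 < v"
    and ball: "\<And>x \<rho>. 0 < \<rho> \<Longrightarrow> v * \<rho> powr N \<le> measure (wmeas w) (ball x \<rho>)"
  shows "\<exists>C. weighted_heat_kernel w \<Gamma> C N"
proof -
  obtain c C where c: "0 < c" "0 < C" and gauss: "\<And>x y t. 0 < t \<Longrightarrow>
        c * exp (- (dist x y)\<^sup>2 / (c * t))
          \<le> sqrt (measure (wmeas w) (ball x (sqrt t)) * measure (wmeas w) (ball y (sqrt t))) * \<Gamma> x y t"
        "\<And>x y t. 0 < t \<Longrightarrow> sqrt (measure (wmeas w) (ball x (sqrt t)) * measure (wmeas w) (ball y (sqrt t))) * \<Gamma> x y t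
          \<le> C * exp (- (dist x y)\<^sup>2 / (C * t))"
    using kernel unfolding kernel_conds_def by blast
  have \<Gamma>0: "0 \<le> \<Gamma> x y t" if "0 < t" for x y t
  proof (rule ccontr)
    assume "\<not> 0 \<le> \<Gamma> x y t"
    then have "sqrt (measure (wmeas w) (ball x (sqrt t)) * measure (wmeas w) (ball y (sqrt t))) * \<Gamma> x y t \<le> 0"
      by (intro mult_nonneg_nonpos) auto
    moreover have "0 < c * exp (- (dist x y)\<^sup>2 / (c * t))" using c by simp
    ultimately show False using gauss(1)[OF that, of x y] by linarith
  qed
  have \<Gamma>_le: "\<Gamma> x y t \<le> C / v * t powr (- (N / 2))" if t: "0 < t" for x y t
  proof -
    define a where "a = v * sqrt t powr N"
    have a: "0 < a" using v t unfolding a_def by simp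
    have "a * a \<le> measure (wmeas w) (ball x (sqrt t)) * measure (wmeas w) (ball y (sqrt t))"
      using ball[of "sqrt t"] a t unfolding a_def by (intro mult_mono) auto
    then have "a \<le> sqrt (measure (wmeas w) (ball x (sqrt t)) * measure (wmeas w) (ball y (sqrt t)))"
      by (intro real_le_rsqrt) (simp add: power2_eq_square)
    then have "a * \<Gamma> x y t \<le> sqrt (measure (wmeas w) (ball x (sqrt t)) * measure (wmeas w) (ball y (sqrt t))) * \<Gamma> x y t"
      by (rule mult_right_mono) (rule \<Gamma>0[OF t])
    also have "\<dots> \<le> C * exp (- (dist x y)\<^sup>2 / (C * t))" by (rule gauss(2)[OF t])
    also have "\<dots> \<le> C * 1" using c t by (intro mult_left_mono) auto
    finally have "\<Gamma> x y t \<le> C / a" using a by (simp add: field_simps)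
    also have "C / a = C / v * t powr (- (N / 2))"
      unfolding a_def using t by (simp add: powr_half_sqrt[symmetric] powr_powr powr_minus_divide)
    finally show ?thesis .
  qed
  have "weighted_heat_kernel w \<Gamma> (C / v) N"
    using w kernel \<Gamma>0 \<Gamma>_le c v N by unfold_locales auto
  then show ?thesis ..
qed

theorem theorem1p2:
  fixes w :: "real^'n \<Rightarrow> real" and \<Gamma> :: "real^'n \<Rightarrow> real^'n \<Rightarrow> real \<Rightarrow> real"
    and \<alpha> p rs :: real and i1 :: 'n
  assumes weight: "(0 \<le> \<alpha> \<and> \<alpha> < 1 \<and> w = weightA i1 \<alpha>)
                 \<or> (0 \<le> \<alpha> \<and> \<alpha> < real CARD('n) \<and> w = weightB \<alpha>)"
    and kernel: "kernel_conds w \<Gamma>"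
    and p: "p > 1 + 2 / (real CARD('n) + \<alpha>)"
    and rs: "rs = (real CARD('n) + \<alpha>) / 2 * (p - 1)"
  shows "rs > 1 \<and>
    (\<exists>\<delta>>0. \<forall>u0. u0 \<in> borel_measurable lebesgue \<and> (\<forall>x. 0 \<le> u0 x) \<and> Linf u0 < \<infinity> \<and>
        wweak w rs u0 < ennreal \<delta> \<longrightarrow>
      (\<exists>u. global_solution w \<Gamma> p u0 u) \<and>
      (\<forall>u v. global_solution w \<Gamma> p u0 u \<longrightarrow> global_solution w \<Gamma> p u0 v \<longrightarrow>
         (\<forall>t>0. AE x in lebesgue. u x t = v x t)) \<and>
      (\<forall>u. global_solution w \<Gamma> p u0 u \<longrightarrow>
         (\<forall>q. rs \<le> q \<longrightarrow>
            (SUP t\<in>{0<..}. ennreal ((1 + t) powr ((real CARD('n) + \<alpha>) / 2 * (1 / rs - 1 / q)))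
                             * wweak w q (\<lambda>x. u x t)) < \<infinity>) \<and>
         (SUP t\<in>{0<..}. ennreal ((1 + t) powr ((real CARD('n) + \<alpha>) / 2 * (1 / rs)))
                          * Linf (\<lambda>x. u x t)) < \<infinity>)) \<and>
    (\<forall>r. 1 \<le> r \<and> r \<le> rs \<longrightarrow>
      (\<exists>\<delta>>0. \<forall>u0. u0 \<in> borel_measurable lebesgue \<and> (\<forall>x. 0 \<le> u0 x) \<and> Linf u0 < \<infinity> \<and>
          wLnorm w r u0 < \<infinity> \<and>
          enn2real (wLnorm w r u0) powr (r / rs) * enn2real (Linf u0) powr (1 - r / rs) < \<delta> \<longrightarrow>
        (\<exists>u. global_solution w \<Gamma> p u0 u) \<and>
        (\<forall>u v. global_solution w \<Gamma> p u0 u \<longrightarrow> global_solution w \<Gamma> p u0 v \<longrightarrow>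
           (\<forall>t>0. AE x in lebesgue. u x t = v x t)) \<and>
        (\<forall>u. global_solution w \<Gamma> p u0 u \<longrightarrow>
           (\<forall>q. r \<le> q \<longrightarrow>
              (SUP t\<in>{0<..}. ennreal ((1 + t) powr ((real CARD('n) + \<alpha>) / 2 * (1 / r - 1 / q)))
                               * wLnorm w q (\<lambda>x. u x t)) < \<infinity>) \<and>
           (SUP t\<in>{0<..}. ennreal ((1 + t) powr ((real CARD('n) + \<alpha>) / 2 * (1 / r)))
                            * Linf (\<lambda>x. u x t)) < \<infinity>)))"
proof -
  let ?N = "real CARD('n) + \<alpha>"
  have \<alpha>: "0 \<le> \<alpha>" using weight by auto
  then have N: "0 < ?N" by (simp add: add_pos_nonneg)
  have p1: "1 < p"
  proof -
    have "0 < 2 / ?N" using N by simp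
    then show ?thesis using p by linarith
  qed
  have rs1: "1 < rs"
  proof -
    have "2 / ?N < p - 1" using p by linarith
    then show ?thesis unfolding rs using N by (simp add: pos_divide_less_eq mult.commute)
  qed
  \<comment> \<open>The two cases meet in these four properties; from here on the weight is not
    inspected again.\<close>
  have "w \<in> borel_measurable borel \<and> (\<forall>x. 0 \<le> w x) \<and>
      (\<forall>x \<rho> y. 0 < \<rho> \<longrightarrow> y \<in> ball x \<rho> \<longrightarrow> w y \<le> 1 + (norm x + \<rho>) powr \<alpha>) \<and>
      (\<forall>x \<rho>. 0 < \<rho> \<longrightarrow> (\<exists>z. ball z (\<rho> / 4) \<subseteq> ball x \<rho> \<and> (\<forall>y\<in>ball z (\<rho> / 4). (\<rho> / 4) powr \<alpha> \<le> w y)))"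
    using weight
  proof (elim disjE conjE)
    assume "w = weightA i1 \<alpha>"
    then show ?thesis by (simp only:) (intro conjI allI impI weightA_facts[OF \<alpha>])
  next
    assume "w = weightB \<alpha>"
    then show ?thesis by (simp only:) (intro conjI allI impI weightB_facts[OF \<alpha>])
  qed
  then have w: "w \<in> borel_measurable borel" "\<And>x. 0 \<le> w x"
      "\<And>x y \<rho>. 0 < \<rho> \<Longrightarrow> y \<in> ball x \<rho> \<Longrightarrow> w y \<le> 1 + (norm x + \<rho>) powr \<alpha>"
      "\<And>x \<rho>. 0 < \<rho> \<Longrightarrow> \<exists>z. ball z (\<rho> / 4) \<subseteq> ball x \<rho> \<and> (\<forall>y\<in>ball z (\<rho> / 4). (\<rho> / 4) powr \<alpha> \<le> w y)"
    by blast+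
  define v where "v = unit_ball_vol (real CARD('n)) * (1 / 4) powr ?N"
  have v: "0 < v" unfolding v_def by simp
  have ball: "v * \<rho> powr ?N \<le> measure (wmeas w) (ball x \<rho>)" if \<rho>: "0 < \<rho>" for x \<rho>
  proof -
    obtain z where z: "ball z (\<rho> / 4) \<subseteq> ball x \<rho>" "\<And>y. y \<in> ball z (\<rho> / 4) \<Longrightarrow> (\<rho> / 4) powr \<alpha> \<le> w y"
      using w(4)[OF \<rho>] by blast
    show ?thesis
      using measure_wmeas_ball_ge[OF w(1,2) \<rho> w(3)[OF \<rho>] z] unfolding v_def by simp
  qed
  obtain C where "weighted_heat_kernel w \<Gamma> C ?N"
    using weighted_heat_kernelI[OF w(1,2) kernel N v ball] by blast
  then interpret weighted_heat_kernel w \<Gamma> C ?N .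
  show ?thesis
    by (rule conjI[OF rs1], rule conjI[OF weak_theorem[OF p1 rs rs1]], intro allI impI, elim conjE,
        rule strong_theorem[OF p1 rs rs1])
qed

end
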